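(* Consider the entire function $$h(z)=\exp(g(z)),\qquad\text{where}\quad g(z)=\sum_{k=1}^{\infty}\left(\frac{z}{2^k}\right)^{2^k}.$$ Then $h$ has infinitely many direct singularities, but no logarithmic singularity over any finite value, and $h$ is in the Eremenko-Lyubich class $\mathcal{B}$.
   Context: Singularities here are those of the inverse function. Let $f$ be an entire function and let $a\in\hat{\mathbb{C}}$. For $r>0$, let $D(a,r)$ be the open disc centered at $a$ with radius $r$ in the spherical metric, and let $U_r$ be a component of $f^{-1}(D(a,r))$, chosen so that $r_1<r_2$ implies $U_{r_1}\subset U_{r_2}$. Then either $\bigcap_r U_r=\{z\}$ for some unique $z\in\mathbb{C}$, or $\bigcap_r U_r=\emptyset$. In the second case there is a transcendental singularity over $a$. It is called direct if there exists $r>0$ such that $f(z)\neq a$ for all $z\in U_r$. A direct singularity over $a$ is called logarithmic if, for some $r>0$, $f:U_r\to D(a,r)\setminus\{a\}$ is a universal covering. A point $z$ with $f'(z)=0$ is a critical point of $f$, and $f(z)$ is then a critical value. If $\Gamma:[0,\infty)\to\mathbb{C}$ is a curve with $|\Gamma(t)|\to\infty$ and $f(\Gamma(t))\to a$ as $t\to\infty$, then $a\in\hat{\mathbb{C}}$ is an asymptotic value of $f$. The Eremenko-Lyubich class $\mathcal{B}$ is the class of transcendental entire functions for which the set of (finite) critical and asymptotic values is bounded. *)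

theory Defs
  imports "HOL-Complex_Analysis.Complex_Analysis"
begin

datatype rsphere = Fin complex | Infty

text \<open>
  Inverse stereographic projection onto the unit sphere of \<open>\<complex> \<times> \<real>\<close>; the
  spherical metric is the great-circle distance, i.e. the length metric of
  \<open>2 |dz| / (1 + |z|\<^sup>2)\<close>.
\<close>

fun stereo :: "rsphere \<Rightarrow> complex \<times> real" where
  "stereo (Fin z) = ((2 / (1 + (cmod z)\<^sup>2)) *\<^sub>R z, ((cmod z)\<^sup>2 - 1) / (1 + (cmod z)\<^sup>2))"
| "stereo Infty = (0, 1)"

lemma inner_stereo_self: "stereo x \<bullet> stereo x = 1"
proof (cases x)
  case (Fin z)
  define s where "s = (cmod z)\<^sup>2"
  have "1 + s > 0" by (simp add: s_def add_pos_nonneg)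
  moreover have "z \<bullet> z = s" by (simp add: s_def power2_norm_eq_inner)
  ultimately show ?thesis
    using Fin by (simp add: s_def[symmetric] divide_simps) (simp add: algebra_simps)
qed simp

lemma norm_stereo: "norm (stereo x) = 1"
  by (simp add: norm_eq_sqrt_inner inner_stereo_self)

lemma stereo_inject: "stereo x = stereo y \<longleftrightarrow> x = y"
proof -
  have pos: "1 + (cmod z)\<^sup>2 > 0" for z by (simp add: add_pos_nonneg)
  have 1: "snd (stereo (Fin z)) \<noteq> 1" for z
    using pos[of z] by (simp add: divide_simps)
  have 2: "z = w" if "stereo (Fin z) = stereo (Fin w)" for z w
  proof -
    have "((cmod z)\<^sup>2 - 1) / (1 + (cmod z)\<^sup>2) = ((cmod w)\<^sup>2 - 1) / (1 + (cmod w)\<^sup>2)"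
      using that by simp
    then have "(cmod z)\<^sup>2 = (cmod w)\<^sup>2"
      using pos[of z] pos[of w] by (simp add: field_simps)
    then show ?thesis
      using that pos[of w] by simp
  qed
  show ?thesis
    using 1 2 by (cases x; cases y) (auto simp del: stereo.simps(1), (metis snd_conv)+)
qed

lemma abs_inner_stereo_le: "\<bar>stereo x \<bullet> stereo y\<bar> \<le> 1"
  using Cauchy_Schwarz_ineq2[of "stereo x" "stereo y"] by (simp add: norm_stereo)

lemma arccos_inner_triangle:
  fixes u v w :: "'a::real_inner"
  assumes "norm u = 1" "norm v = 1" "norm w = 1"
  shows "arccos (u \<bullet> w) \<le> arccos (u \<bullet> v) + arccos (v \<bullet> w)"
proof -
  have bd: "\<bar>x \<bullet> y\<bar> \<le> 1" if "norm x = 1" "norm y = 1" for x y :: 'a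
    using Cauchy_Schwarz_ineq2[of x y] that by simp
  define \<alpha> \<beta> where "\<alpha> = arccos (u \<bullet> v)" and "\<beta> = arccos (v \<bullet> w)"
  have uv: "\<bar>u \<bullet> v\<bar> \<le> 1" and vw: "\<bar>v \<bullet> w\<bar> \<le> 1" and uw: "\<bar>u \<bullet> w\<bar> \<le> 1"
    using bd assms by auto
  have 1: "u \<bullet> u = 1" "v \<bullet> v = 1" "w \<bullet> w = 1"
    using assms by (simp_all add: norm_eq_1)
  have ab: "0 \<le> \<alpha>" "0 \<le> \<beta>"
    using uv vw by (auto simp: \<alpha>_def \<beta>_def abs_le_iff intro!: arccos_lbound)
  show ?thesis
  proof (cases "\<alpha> + \<beta> \<le> pi")
    case False
    moreover have "arccos (u \<bullet> w) \<le> pi" using uw by (intro arccos_ubound) auto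
    ultimately show ?thesis by (simp add: \<alpha>_def \<beta>_def)
  next
    case True
    define p q where "p = u - (u \<bullet> v) *\<^sub>R v" and "q = w - (v \<bullet> w) *\<^sub>R v"
    have "p \<bullet> p = 1 - (u \<bullet> v)\<^sup>2" "q \<bullet> q = 1 - (v \<bullet> w)\<^sup>2" "p \<bullet> q = u \<bullet> w - (u \<bullet> v) * (v \<bullet> w)"
      by (simp_all add: p_def q_def inner_diff_left inner_diff_right 1 power2_eq_square
          inner_commute algebra_simps)
    moreover have "sin \<alpha> = sqrt (1 - (u \<bullet> v)\<^sup>2)" "sin \<beta> = sqrt (1 - (v \<bullet> w)\<^sup>2)"
      using uv vw by (auto simp: \<alpha>_def \<beta>_def abs_le_iff intro!: sin_arccos_abs)
    ultimately have "- (sin \<alpha> * sin \<beta>) \<le> u \<bullet> w - (u \<bullet> v) * (v \<bullet> w)"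
      using Cauchy_Schwarz_ineq2[of p q] by (simp add: norm_eq_sqrt_inner abs_le_iff)
    moreover have "cos \<alpha> = u \<bullet> v" "cos \<beta> = v \<bullet> w"
      using uv vw by (auto simp: \<alpha>_def \<beta>_def abs_le_iff intro!: cos_arccos)
    ultimately have "cos (\<alpha> + \<beta>) \<le> u \<bullet> w"
      by (simp add: cos_add)
    then have "arccos (u \<bullet> w) \<le> arccos (cos (\<alpha> + \<beta>))"
      using uw by (intro arccos_le_arccos) auto
    also have "\<dots> = \<alpha> + \<beta>"
      using ab True by (intro arccos_cos) auto
    finally show ?thesis by (simp add: \<alpha>_def \<beta>_def)
  qed
qed

instantiation rsphere :: metric_space
begin

definition dist_rsphere :: "rsphere \<Rightarrow> rsphere \<Rightarrow> real" where
  "dist_rsphere x y = arccos (stereo x \<bullet> stereo y)"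

definition uniformity_rsphere :: "(rsphere \<times> rsphere) filter" where
  "uniformity_rsphere = (INF e\<in>{0<..}. principal {(x, y). dist x y < e})"

definition open_rsphere :: "rsphere set \<Rightarrow> bool" where
  "open_rsphere U \<longleftrightarrow> (\<forall>x\<in>U. eventually (\<lambda>(x', y). x' = x \<longrightarrow> y \<in> U) uniformity)"

instance
proof
  fix x y z :: rsphere
  show "dist x y = 0 \<longleftrightarrow> x = y"
  proof
    assume "dist x y = 0"
    then have "cos (arccos (stereo x \<bullet> stereo y)) = 1"
      by (simp add: dist_rsphere_def)
    then have "stereo x \<bullet> stereo y = 1"
      using abs_inner_stereo_le[of x y] by (simp add: abs_le_iff)
    then have "(stereo x - stereo y) \<bullet> (stereo x - stereo y) = 0"
      by (simp add: inner_diff_left inner_diff_right inner_stereo_self inner_commute)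
    then show "x = y"
      by (simp add: stereo_inject)
  qed (simp add: dist_rsphere_def inner_stereo_self)
  show "dist x y \<le> dist x z + dist y z"
    using arccos_inner_triangle[of "stereo x" "stereo z" "stereo y"]
    by (simp add: dist_rsphere_def norm_stereo inner_commute)
qed (rule uniformity_rsphere_def open_rsphere_def)+

end


text \<open>
  A singularity over \<open>a\<close> is the whole choice \<open>r \<mapsto> U\<^sub>r\<close>, so that several singularities
  may lie over the same \<open>a\<close>. Only the values at \<open>r > 0\<close> matter; \<open>U\<close> is made empty
  elsewhere so that distinct \<open>U\<close> are distinct singularities.
\<close>

definition transcendental_singularity ::
    "(complex \<Rightarrow> complex) \<Rightarrow> rsphere \<Rightarrow> (real \<Rightarrow> complex set) \<Rightarrow> bool" where
  "transcendental_singularity f a U \<longleftrightarrow>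
     (\<forall>r>0. U r \<in> components {z. Fin (f z) \<in> ball a r}) \<and>
     (\<forall>r\<le>0. U r = {}) \<and>
     (\<forall>r1 r2. 0 < r1 \<and> r1 < r2 \<longrightarrow> U r1 \<subseteq> U r2) \<and>
     (\<Inter>r\<in>{0<..}. U r) = {}"

definition direct_singularity ::
    "(complex \<Rightarrow> complex) \<Rightarrow> rsphere \<Rightarrow> (real \<Rightarrow> complex set) \<Rightarrow> bool" where
  "direct_singularity f a U \<longleftrightarrow>
     transcendental_singularity f a U \<and> (\<exists>r>0. \<forall>z\<in>U r. Fin (f z) \<noteq> a)"

definition universal_covering ::
    "'a::real_normed_vector set \<Rightarrow> ('a \<Rightarrow> 'b::topological_space) \<Rightarrow> 'b set \<Rightarrow> bool" where
  "universal_covering X p S \<longleftrightarrow> covering_space X p S \<and> simply_connected X"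

definition logarithmic_singularity ::
    "(complex \<Rightarrow> complex) \<Rightarrow> rsphere \<Rightarrow> (real \<Rightarrow> complex set) \<Rightarrow> bool" where
  "logarithmic_singularity f a U \<longleftrightarrow>
     direct_singularity f a U \<and>
     (\<exists>r>0. universal_covering (U r) (\<lambda>z. Fin (f z)) (ball a r - {a}))"


definition critical_values :: "(complex \<Rightarrow> complex) \<Rightarrow> complex set" where
  "critical_values f = f ` {z. deriv f z = 0}"

definition asymptotic_value :: "(complex \<Rightarrow> complex) \<Rightarrow> rsphere \<Rightarrow> bool" where
  "asymptotic_value f a \<longleftrightarrow>
     (\<exists>\<Gamma> :: real \<Rightarrow> complex. continuous_on {0..} \<Gamma> \<and>
        filterlim (\<lambda>t. cmod (\<Gamma> t)) at_top at_top \<and>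
        ((\<lambda>t. Fin (f (\<Gamma> t))) \<longlongrightarrow> a) at_top)"

definition transcendental_entire :: "(complex \<Rightarrow> complex) \<Rightarrow> bool" where
  "transcendental_entire f \<longleftrightarrow>
     f holomorphic_on UNIV \<and> \<not> (\<exists>p. \<forall>z. f z = poly p z)"

definition class_B :: "(complex \<Rightarrow> complex) set" where
  "class_B = {f. transcendental_entire f \<and>
     bounded (critical_values f \<union> {a. asymptotic_value f (Fin a)})}"


definition g :: "complex \<Rightarrow> complex" where
  "g z = (\<Sum>k. (z / 2 ^ Suc k) ^ (2 ^ Suc k))"

definition h :: "complex \<Rightarrow> complex" where
  "h z = exp (g z)"

lemma summable_g: "summable (\<lambda>k. (z / 2 ^ Suc k :: complex) ^ (2 ^ Suc k))"
proof -
  obtain N where N: "2 * cmod z < 2 ^ N"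
    using real_arch_pow[of 2 "2 * cmod z"] by auto
  show ?thesis
  proof (rule summable_comparison_test')
    show "summable (\<lambda>k. (1 / 2 :: real) ^ k)" by simp
    fix k assume "N \<le> k"
    then have "(2::real) ^ N \<le> 2 ^ Suc k" by (intro power_increasing) auto
    with N have "cmod (z / 2 ^ Suc k) \<le> 1 / 2"
      by (simp add: norm_divide norm_power norm_mult divide_simps)
    then have "cmod ((z / 2 ^ Suc k) ^ (2 ^ Suc k)) \<le> (1 / 2) ^ (2 ^ Suc k)"
      unfolding norm_power by (intro power_mono) auto
    also have "\<dots> \<le> (1 / 2) ^ k"
    proof (rule power_decreasing)
      have "k < 2 ^ k" by (rule less_exp)
      also have "(2::nat) ^ k \<le> 2 ^ Suc k" by simp
      finally show "k \<le> 2 ^ Suc k" by simp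
    qed auto
    finally show "norm ((z / 2 ^ Suc k) ^ (2 ^ Suc k)) \<le> (1 / 2) ^ k" .
  qed
qed

end

theory Submission
  imports Defs "HOL-Real_Asymp.Real_Asymp" "HOL-Computational_Algebra.Fundamental_Theorem_Algebra"
begin


text \<open>
  Write \<open>t k\<close> for the term of \<open>g\<close> with summation index \<open>k\<close>, so that \<open>t k = (z / 2^(k+1))^(2^(k+1))\<close>.
  Consecutive terms are tied by \<open>t (k+1) = (t k)\<^sup>2 / A k\<close> with \<open>A k = 4^(2^(k+1))\<close>, and on the
  circle \<open>|z| = 2^(n+3)\<close> the terms \<open>t n\<close> and \<open>t (n+1)\<close> have the common modulus \<open>A n\<close>,
  while all others are negligible. In a wide annulus around this circle, with a logarithmic coordinate
  \<open>\<zeta>\<close> for which \<open>t n = A n * exp \<zeta>\<close>, this reads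
  \<open>g = A n * exp \<zeta> * (1 + exp \<zeta> + err)\<close> with a uniformly small error (\<open>g_chart\<close>,
  \<open>norm_err_le\<close>). These annuli cover a neighbourhood of infinity (\<open>exists_chart_eq\<close>), so \<open>g\<close> may
  be replaced by \<open>A (w + w\<^sup>2)\<close>, \<open>w = exp \<zeta>\<close>, throughout.

  Class \<open>\<B>\<close>: the critical points of \<open>A (w + w\<^sup>2)\<close> lie at \<open>w = -1/2\<close>, where the value is \<open>-A/4\<close>.
  Hence all but finitely many critical values of \<open>h = exp g\<close> lie in the unit disc
  (\<open>Re_g_critical\<close>). On the circles \<open>|w| = 2\<close> the modulus of \<open>g\<close> tends to infinity. A
  connected set on which \<open>h\<close> stays close to some \<open>a \<noteq> 0\<close> has a bounded image under \<open>g\<close>,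
  a branch of \<open>log h\<close>, and therefore cannot cross these circles (\<open>bounded_where_h_near_nonzero\<close>). So
  there is neither an asymptotic value nor a transcendental singularity over \<open>a \<in> \<complex> - {0}\<close>.

  No logarithmic singularity over \<open>0\<close>: such a singularity gives unbounded components \<open>U\<close> of
  half-plane preimages \<open>{z. Re (g z) < L}\<close>. For large \<open>n\<close>, \<open>U\<close> crosses the circle
  \<open>|w| = 1/4\<close>; moving along it towards \<open>w = -1/4\<close> and on to \<open>w = -1/2\<close> keeps
  \<open>Re g\<close> below \<open>L\<close>, so that \<open>U\<close> contains a critical point
  (\<open>unbounded_left_component_has_critical_point\<close>), where a covering map has none.

  Infinitely many direct singularities: on the ray \<open>arg z = \<pi>/2^m\<close> all but finitely many terms are
  positive, so \<open>h\<close> tends to infinity along it; as \<open>h\<close> omits infinity, this gives a direct singularity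
  over infinity. Different rays are separated by the directions \<open>arg z = \<plusminus> 2\<pi>/(3 * 2^m)\<close>, in which
  \<open>2^k * arg z\<close> is eventually \<open>\<plusminus> 2\<pi>/3\<close> modulo \<open>2\<pi>\<close>, so that the terms eventually have negative
  real part and \<open>Re g\<close> is bounded above (\<open>tract_ridge_ray_distinct\<close>).
\<close>

section \<open>The terms of the series\<close>

definition term_size :: "nat \<Rightarrow> real \<Rightarrow> real" where
  "term_size k r = (r / 2 ^ Suc k) ^ (2 ^ Suc k)"

lemma norm_g_term: "cmod ((z / 2 ^ Suc k) ^ (2 ^ Suc k)) = term_size k (cmod z)"
  by (simp add: term_size_def norm_power norm_divide norm_mult)

lemma term_size_nonneg: "0 \<le> r \<Longrightarrow> 0 \<le> term_size k r"
  by (simp add: term_size_def)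

lemma term_size_mono: "0 \<le> r \<Longrightarrow> r \<le> s \<Longrightarrow> term_size k r \<le> term_size k s"
  unfolding term_size_def by (intro power_mono divide_right_mono) auto

lemma summable_term_size: "summable (\<lambda>k. term_size k (cmod z))"
proof -
  have "summable (\<lambda>k. (complex_of_real (cmod z) / 2 ^ Suc k) ^ (2 ^ Suc k))"
    by (rule summable_g)
  also have "(\<lambda>k. (complex_of_real (cmod z) / 2 ^ Suc k) ^ (2 ^ Suc k))
      = (\<lambda>k. complex_of_real (term_size k (cmod z)))"
    by (simp add: term_size_def)
  finally show ?thesis by (simp only: summable_of_real_iff)
qed

text \<open>
  The ratio of consecutive terms decides which terms dominate: it is large while \<open>2^(k+3)\<close> is
  smaller than \<open>r\<close>, and small afterwards.
\<close>

lemma term_size_Suc: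
  "term_size (Suc k) r = term_size k r * (r / 2 ^ (k + 3)) ^ (2 ^ Suc k)"
proof -
  have "term_size (Suc k) r = ((r / 2 ^ (k + 2))\<^sup>2) ^ (2 ^ Suc k)"
    by (simp add: term_size_def power_mult[symmetric])
  also have "(r / 2 ^ (k + 2))\<^sup>2 = (r / 2 ^ Suc k) * (r / 2 ^ (k + 3))"
    by (simp add: power2_eq_square field_simps power_add)
  finally show ?thesis by (simp only: term_size_def power_mult_distrib)
qed

text \<open>
  On the unit disc around \<open>x\<close> the terms are dominated by their sizes at radius \<open>|x| + 1\<close>.
\<close>

lemma holomorphic_g: "g holomorphic_on UNIV"
proof -
  let ?t = "\<lambda>k z. (z / 2 ^ Suc k :: complex) ^ (2 ^ Suc k)"
  have dom: "\<exists>d h. 0 < d \<and> summable h \<and> range h \<subseteq> \<real>\<^sub>\<ge>\<^sub>0 \<and>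
      (\<forall>\<^sub>F n in sequentially. \<forall>y\<in>ball x d \<inter> UNIV. cmod (?t n y) \<le> cmod (h n))" for x :: complex
  proof -
    have "\<forall>\<^sub>F k in sequentially. \<forall>y\<in>ball x 1 \<inter> UNIV.
        cmod ((y / 2 ^ Suc k) ^ (2 ^ Suc k)) \<le> term_size k (cmod (complex_of_real (cmod x + 1)))"
    proof (intro always_eventually allI ballI)
      fix k y assume "y \<in> ball x 1 \<inter> UNIV"
      then have "cmod (y - x) < 1" by (simp add: dist_norm norm_minus_commute)
      then have "cmod y \<le> cmod x + 1" using norm_triangle_ineq2[of y x] by linarith
      moreover have "cmod (complex_of_real (cmod x + 1)) = cmod x + 1"
        by (metis abs_of_nonneg add_nonneg_nonneg norm_ge_zero norm_of_real zero_le_one)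
      ultimately show "cmod ((y / 2 ^ Suc k) ^ (2 ^ Suc k)) \<le> term_size k (cmod (complex_of_real (cmod x + 1)))"
        unfolding norm_g_term by (intro term_size_mono) auto
    qed
    then show ?thesis
      apply (intro exI[of _ 1] exI[of _ "\<lambda>k. complex_of_real (term_size k (cmod (complex_of_real (cmod x + 1))))"] conjI)
      using summable_term_size[of "complex_of_real (cmod x + 1)"]
         apply (auto simp: summable_of_real_iff nonneg_Reals_of_real_iff term_size_nonneg simp del: of_real_add)
      done
  qed
  have "?t k field_differentiable at x" for k x
    by (intro field_differentiable_power field_differentiable_divide derivative_intros) auto
  then obtain g' where "\<forall>x\<in>UNIV. ((\<lambda>k. ?t k x) sums g' x) \<and> g' field_differentiable at x"
    using series_differentiable_comparison_complex[OF open_UNIV _ dom] by blast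
  then have g': "\<And>x. (\<lambda>k. ?t k x) sums g' x" "\<And>x. g' field_differentiable at x" by auto
  have "g = g'" unfolding g_def using g'(1) by (auto simp: fun_eq_iff sums_iff)
  with g'(2) show ?thesis by (auto simp: holomorphic_on_def field_differentiable_at_within)
qed

lemma continuous_on_g: "continuous_on S g"
  using holomorphic_g holomorphic_on_imp_continuous_on holomorphic_on_subset by blast


text \<open>
  Relative size, compared with term \<open>n\<close>, of all terms other than \<open>n\<close> and \<open>n+1\<close> in the annulus
  \<open>2/3 \<le> |z| / 2^(n+3) \<le> 3/2\<close>. The first summand accounts for the \<open>n\<close> smaller indices, where
  \<open>3/4 = 1 / (2 * 2/3)\<close>; the second for the larger ones, where
  \<open>27/32 = \<rho> * (\<rho>/2)\<^sup>2\<close> at \<open>\<rho> = 3/2\<close>.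
\<close>

definition tail_bound :: "nat \<Rightarrow> real" where
  "tail_bound n = real n * (3/4) ^ (2 ^ n) + 2 * (27/32) ^ (2 ^ Suc n)"

lemma tail_bound_tendsto_0: "tail_bound \<longlonglongrightarrow> 0"
proof (rule tendsto_sandwich[where f="\<lambda>_. 0"])
  have pw: "(q::real) ^ (2 ^ n) \<le> q ^ n" if "0 \<le> q" "q \<le> 1" for q n
    using that less_exp[of n] by (intro power_decreasing) auto
  show "\<forall>\<^sub>F n in sequentially. tail_bound n \<le> real n * (3/4) ^ n + 2 * (27/32) ^ Suc n"
    unfolding tail_bound_def by (intro always_eventually allI add_mono mult_left_mono pw) auto
  have "(\<lambda>n. real n * (3/4) ^ n) \<longlonglongrightarrow> 0"
    using powser_times_n_limit_0[of "3/4::real"] by simp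
  moreover have "(\<lambda>n. 2 * (27/32::real) ^ Suc n) \<longlonglongrightarrow> 2 * 0"
    by (intro tendsto_mult tendsto_const LIMSEQ_power_zero LIMSEQ_Suc) auto
  ultimately show "(\<lambda>n. real n * (3/4) ^ n + 2 * (27/32::real) ^ Suc n) \<longlonglongrightarrow> 0"
    using tendsto_add by fastforce
qed (auto simp: tail_bound_def)

lemma eventually_tail_bound_le: "\<forall>\<^sub>F n in sequentially. tail_bound n \<le> 1/100"
  using order_tendstoD(2)[OF tail_bound_tendsto_0, of "1/100"] by (auto elim: eventually_mono)

text \<open>
  Below index \<open>n\<close> the terms increase with the index, so each is at most the term just before \<open>n\<close>, which
  is already smaller than term \<open>n\<close> by the factor \<open>(3/4)^(2^n)\<close>.
\<close>

lemma sum_small_terms_le: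
  assumes r: "2/3 \<le> r / 2 ^ (n + 3)" 
  shows "(\<Sum>k<n. term_size k r) \<le> real n * (3/4) ^ (2 ^ n) * term_size n r"
proof -
  have "0 \<le> r / 2 ^ (n + 3)" using r by linarith
  then have "0 \<le> (r / 2 ^ (n + 3)) * 2 ^ (n + 3)" by (intro mult_nonneg_nonneg) auto
  then have "r \<ge> 0" by simp
  have "term_size k r \<le> (3/4) ^ (2 ^ n) * term_size n r" if "k < n" for k
  proof -
    obtain m where m: "n = Suc m" using \<open>k < n\<close> by (cases n) auto
    have "4/3 \<le> r / 2 ^ (m + 3)" using r by (simp add: m field_simps power_add)
    then have "(4/3) ^ (2 ^ Suc m) \<le> (r / 2 ^ (m + 3)) ^ (2 ^ Suc m)"
      by (intro power_mono) auto
    then have "term_size m r * (4/3) ^ (2 ^ Suc m) \<le> term_size n r"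
      unfolding m term_size_Suc using term_size_nonneg[OF \<open>r \<ge> 0\<close>] by (intro mult_left_mono)
    then have *: "term_size m r \<le> (3/4) ^ (2 ^ n) * term_size n r"
      by (simp add: m power_divide field_simps)
    have "k \<le> m" using \<open>k < n\<close> m by simp
    then have "term_size k r \<le> term_size m r"
    proof (induction rule: inc_induct)
      case (step j)
      have "(2::real) ^ (j + 3) \<le> 2 ^ (m + 3)" using step by (intro power_increasing) auto
      also have "1 \<le> r / 2 ^ (m + 3)" using \<open>4/3 \<le> r / 2 ^ (m + 3)\<close> by linarith
      then have "2 ^ (m + 3) \<le> r" by (simp add: field_simps)
      finally have "1 \<le> r / 2 ^ (j + 3)" by (simp add: field_simps)
      then have "1 \<le> (r / 2 ^ (j + 3)) ^ (2 ^ Suc j)" by (intro one_le_power)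
      then have "term_size j r * 1 \<le> term_size (Suc j) r"
        unfolding term_size_Suc using term_size_nonneg[OF \<open>r \<ge> 0\<close>] by (intro mult_left_mono)
      with step.IH show ?case by simp
    qed simp
    with * show ?thesis by simp
  qed
  then have "(\<Sum>k<n. term_size k r) \<le> (\<Sum>k<n. (3/4) ^ (2 ^ n) * term_size n r)"
    by (intro sum_mono) auto
  then show ?thesis by simp
qed

text \<open>
  Term \<open>n+2\<close> carries the factor \<open>(27/32)^(2^(n+1))\<close>, and from there on the terms at least halve.
\<close>

lemma suminf_small_terms_le:
  assumes r: "0 \<le> r" "r / 2 ^ (n + 3) \<le> 3/2" 
  shows "(\<Sum>j. term_size (j + (n + 2)) r) \<le> 2 * (27/32) ^ (2 ^ Suc n) * term_size n r"
proof -
  define \<rho> where "\<rho> = r / 2 ^ (n + 3)"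
  have \<rho>: "0 \<le> \<rho>" "\<rho> \<le> 3/2" using r by (auto simp: \<rho>_def)
  have "term_size (n + 2) r = term_size n r * \<rho> ^ (2 ^ Suc n) * (r / 2 ^ (n + 4)) ^ (2 ^ (n + 2))"
  proof -
    have "n + 2 = Suc (Suc n)" "n + 4 = Suc n + 3" by auto
    then show ?thesis by (simp only: term_size_Suc \<rho>_def)
  qed
  also have "r / 2 ^ (n + 4) = \<rho> / 2"
    by (simp add: \<rho>_def power_add)
  also have "(\<rho> / 2) ^ (2 ^ (n + 2)) = ((\<rho> / 2)\<^sup>2) ^ (2 ^ Suc n)"
    by (subst power_mult[symmetric]) simp
  also have "term_size n r * \<rho> ^ (2 ^ Suc n) * ((\<rho> / 2)\<^sup>2) ^ (2 ^ Suc n)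
      = (\<rho> * (\<rho> / 2)\<^sup>2) ^ (2 ^ Suc n) * term_size n r"
    by (simp only: power_mult_distrib mult_ac)
  also have "\<dots> \<le> (27/32) ^ (2 ^ Suc n) * term_size n r"
  proof (intro mult_right_mono power_mono term_size_nonneg)
    have "\<rho> * (\<rho> / 2)\<^sup>2 \<le> 3/2 * ((3/2) / 2)\<^sup>2"
      using \<rho> by (intro mult_mono power_mono) auto
    then show "\<rho> * (\<rho> / 2)\<^sup>2 \<le> 27/32" by (simp add: power2_eq_square)
  qed (use \<rho> r in auto)
  finally have first: "term_size (n + 2) r \<le> (27/32) ^ (2 ^ Suc n) * term_size n r" .
  have geo: "term_size (j + (n + 2)) r \<le> (1/2) ^ j * term_size (n + 2) r" for j
  proof (induction j)
    case (Suc j)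
    have "r / 2 ^ (j + (n + 2) + 3) \<le> r / 2 ^ (n + 5)"
      using r by (intro divide_left_mono power_increasing) auto
    also have "\<dots> = \<rho> / 4" by (simp add: \<rho>_def power_add)
    also have "\<dots> \<le> 1/2" using \<rho> by simp
    finally have "(r / 2 ^ (j + (n + 2) + 3)) ^ (2 ^ Suc (j + (n + 2))) \<le> (1/2) ^ (2 ^ Suc (j + (n + 2)))"
      by (rule power_mono) (use r in simp)
    also have "\<dots> \<le> (1/2) ^ 1" by (intro power_decreasing) auto
    finally have "term_size (Suc (j + (n + 2))) r \<le> term_size (j + (n + 2)) r * (1/2)"
      unfolding term_size_Suc using term_size_nonneg[OF r(1)] by (intro mult_left_mono) simp_all
    with Suc.IH show ?case by simp
  qed simp
  have sm: "summable (\<lambda>j. (1/2::real) ^ j * term_size (n + 2) r)"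
    by (intro summable_mult2) simp
  have "summable (\<lambda>j. term_size (j + (n + 2)) r)"
    using summable_term_size[of "complex_of_real r", THEN summable_ignore_initial_segment[of _ "n+2"]] r by simp
  then have "(\<Sum>j. term_size (j + (n + 2)) r) \<le> (\<Sum>j. (1/2) ^ j * term_size (n + 2) r)"
    by (rule suminf_le[OF geo _ sm])
  also have "\<dots> = 2 * term_size (n + 2) r"
    using suminf_mult2[OF summable_geometric, of "1/2::real" "term_size (n+2) r"] by (simp add: suminf_geometric)
  finally show ?thesis using first by simp
qed

lemma norm_g_minus_two_terms:
  assumes "2/3 \<le> cmod z / 2 ^ (n + 3)" "cmod z / 2 ^ (n + 3) \<le> 3/2"
  shows "cmod (g z - (z / 2 ^ Suc n) ^ (2 ^ Suc n) - (z / 2 ^ Suc (Suc n)) ^ (2 ^ Suc (Suc n)))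
    \<le> tail_bound n * term_size n (cmod z)"
proof -
  let ?t = "\<lambda>k. (z / 2 ^ Suc k) ^ (2 ^ Suc k)"
  have "g z = (\<Sum>j. ?t (j + (n + 2))) + (\<Sum>k<n + 2. ?t k)"
    unfolding g_def by (rule suminf_split_initial_segment[OF summable_g])
  then have "g z - ?t n - ?t (Suc n) = (\<Sum>j. ?t (j + (n + 2))) + (\<Sum>k<n. ?t k)"
    by simp
  then have "cmod (g z - ?t n - ?t (Suc n)) \<le> cmod (\<Sum>j. ?t (j + (n + 2))) + cmod (\<Sum>k<n. ?t k)"
    by (simp only: norm_triangle_ineq)
  moreover have "cmod (\<Sum>j. ?t (j + (n + 2))) \<le> (\<Sum>j. term_size (j + (n + 2)) (cmod z))"
    using summable_norm[of "\<lambda>j. ?t (j + (n + 2))"]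
      summable_term_size[of z, THEN summable_ignore_initial_segment[of _ "n+2"]]
    by (simp only: norm_g_term)
  moreover have "(\<Sum>j. term_size (j + (n + 2)) (cmod z)) \<le> 2 * (27/32) ^ (2 ^ Suc n) * term_size n (cmod z)"
    using assms by (intro suminf_small_terms_le) auto
  moreover have "cmod (\<Sum>k<n. ?t k) \<le> (\<Sum>k<n. term_size k (cmod z))"
    using norm_sum[of ?t "{..<n}"] by (simp only: norm_g_term)
  moreover have "(\<Sum>k<n. term_size k (cmod z)) \<le> real n * (3/4) ^ (2 ^ n) * term_size n (cmod z)"
    using assms by (intro sum_small_terms_le) auto
  moreover have "tail_bound n * term_size n (cmod z) = 
      real n * (3/4) ^ (2 ^ n) * term_size n (cmod z) + 2 * (27/32) ^ (2 ^ Suc n) * term_size n (cmod z)"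
    by (simp only: tail_bound_def distrib_right)
  ultimately show ?thesis by linarith
qed



section \<open>A logarithmic coordinate on the annuli\<close>

text \<open>
  Common modulus of the terms \<open>n\<close> and \<open>n+1\<close> on the circle \<open>|z| = 2^(n+3)\<close>.
\<close>

definition amp :: "nat \<Rightarrow> real" where "amp n = 4 ^ (2 ^ Suc n)"

text \<open>
  The scaling of \<open>\<zeta>\<close> is chosen to turn term \<open>n\<close> into \<open>amp n * exp \<zeta>\<close> and term \<open>n+1\<close> into
  \<open>amp n * exp (2 * \<zeta>)\<close>. Working with \<open>\<zeta>\<close> instead of \<open>exp \<zeta>\<close> separates the \<open>2^(n+1)\<close> sectors
  of the annulus without any choice of roots.
\<close>

definition chart :: "nat \<Rightarrow> complex \<Rightarrow> complex" where
  "chart n \<zeta> = 2 ^ (n + 3) * exp (\<zeta> / 2 ^ Suc n)"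

definition err :: "nat \<Rightarrow> complex \<Rightarrow> complex" where
  "err n \<zeta> = g (chart n \<zeta>) / (of_real (amp n) * exp \<zeta>) - 1 - exp \<zeta>"

lemma amp_pos: "0 < amp n" by (simp add: amp_def)

lemma amp_ge_index: "real n \<le> amp n"
proof -
  have "n < 2 ^ n" by (rule less_exp)
  also have "(2::nat) ^ n \<le> 2 ^ Suc n" by simp
  also have "\<dots> < 2 ^ (2 ^ Suc n)" by (rule less_exp)
  finally have "real n < real (2 ^ (2 ^ Suc n))" by (simp only: of_nat_less_iff)
  also have "\<dots> = 2 ^ (2 ^ Suc n)" by (simp only: of_nat_power of_nat_numeral)
  also have "\<dots> \<le> amp n" unfolding amp_def by (intro power_mono) auto
  finally show ?thesis by simp
qed

lemma chart_nonzero: "chart n \<zeta> \<noteq> 0" by (simp add: chart_def)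

lemma norm_chart: "cmod (chart n \<zeta>) = 2 ^ (n + 3) * exp (Re \<zeta> / 2 ^ Suc n)"
proof -
  have "\<zeta> / 2 ^ Suc n = \<zeta> / complex_of_real (2 ^ Suc n)" by simp
  then have "Re (\<zeta> / 2 ^ Suc n) = Re \<zeta> / 2 ^ Suc n" by (simp only: Re_divide_of_real)
  then show ?thesis unfolding chart_def by (simp only: norm_mult norm_power norm_exp_eq_Re) simp
qed

lemma continuous_on_chart: "continuous_on S (chart n)"
  unfolding chart_def by (intro continuous_intros) auto

lemma DERIV_chart: "(chart n has_field_derivative chart n \<zeta> / 2 ^ Suc n) (at \<zeta>)"
  unfolding chart_def by (auto intro!: derivative_eq_intros)

lemma chart_surj:
  assumes "cmod z = 2 ^ (n + 3) * exp (x / 2 ^ Suc n)"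
  obtains \<zeta> where "Re \<zeta> = x" "chart n \<zeta> = z"
proof
  let ?l = "Ln (z / 2 ^ (n + 3))"
  have nz: "z \<noteq> 0" using assms by auto
  have "cmod (z / 2 ^ (n + 3)) = exp (x / 2 ^ Suc n)"
    using assms by (simp add: norm_divide norm_power)
  then have "Re ?l = x / 2 ^ Suc n" using nz by (subst Re_Ln) auto
  moreover have "2 ^ Suc n * ?l = complex_of_real (2 ^ Suc n) * ?l" by simp
  ultimately show "Re (2 ^ Suc n * ?l) = x" by (simp only: Re_complex_of_real Im_complex_of_real times_complex.sel) simp
  show "chart n (2 ^ Suc n * ?l) = z"
    using nz by (simp add: chart_def)
qed

text \<open>
  With \<open>n + 3\<close> the integer nearest to \<open>log 2 |z|\<close>, the real part of the coordinate is at most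
  \<open>2^(n+1) * ln 2 / 2\<close> in modulus, and \<open>ln 2 / 2 < 7/20 < 2/5 < ln (3/2)\<close>. The gap between \<open>7/20\<close> and
  \<open>2/5\<close> leaves room for Cauchy's estimate below.
\<close>

lemma exists_chart_eq:
  assumes "2 ^ (m + 4) \<le> cmod z"
  obtains n \<zeta> where "m \<le> n" "\<bar>Re \<zeta>\<bar> \<le> 2 ^ Suc n * (7/20)" "chart n \<zeta> = z"
proof -
  have "cmod z > 0" using assms by (smt (verit) zero_less_power)
  define l where "l = log 2 (cmod z)"
  have "real (m + 4) \<le> l"
    unfolding l_def using assms \<open>cmod z > 0\<close> by (subst le_log_iff) (auto simp: powr_realpow simp del: of_nat_add)
  then have "int (m + 4) \<le> round l"
    using round_mono[OF \<open>real (m + 4) \<le> l\<close>] by (simp only: round_of_nat)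
  define n where "n = nat (round l) - 3"
  have n: "m \<le> n" "of_int (round l) = real n + 3"
    using \<open>int (m + 4) \<le> round l\<close> by (auto simp: n_def)
  define x where "x = 2 ^ Suc n * (ln 2 * (l - (real n + 3)))"
  have "cmod z = 2 powr l" using \<open>cmod z > 0\<close> by (simp add: l_def)
  also have "\<dots> = 2 ^ (n + 3) * exp (x / 2 ^ Suc n)"
  proof -
    have "l * ln 2 = real (n + 3) * ln 2 + x / 2 ^ Suc n"
    proof -
      have "x / 2 ^ Suc n = ln 2 * (l - (real n + 3))" by (simp add: x_def)
      then show ?thesis by (simp add: algebra_simps)
    qed
    then have "2 powr l = exp (real (n + 3) * ln 2) * exp (x / 2 ^ Suc n)"
      unfolding powr_def by (simp only: exp_add[symmetric] mult.commute) simp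
    also have "exp (real (n + 3) * ln 2) = exp (ln (2::real)) ^ (n + 3)" by (rule exp_of_nat_mult)
    finally show ?thesis by simp
  qed
  finally obtain \<zeta> where \<zeta>: "Re \<zeta> = x" "chart n \<zeta> = z" by (rule chart_surj)
  have "\<bar>ln 2 * (l - (real n + 3))\<bar> \<le> 7/20"
  proof -
    have "\<bar>l - (real n + 3)\<bar> \<le> 1/2"
      using of_int_round_abs_le[of l] n by (simp add: abs_minus_commute)
    then have "\<bar>ln 2\<bar> * \<bar>l - (real n + 3)\<bar> \<le> (25/36) * (1/2)"
      using ln2_le_25_over_36 by (intro mult_mono) auto
    then show ?thesis by (simp add: abs_mult)
  qed
  then have "\<bar>x\<bar> \<le> 2 ^ Suc n * (7/20)"
    unfolding x_def abs_mult by simp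
  with that n \<zeta> show thesis by blast
qed

lemma exp_2_5_le: "exp (2/5 :: real) \<le> 3/2"
proof -
  have "39/40 \<le> exp (- 1/40 :: real)" using exp_ge_add_one_self[of "-1/40"] by simp
  then have "(39/40) ^ 16 \<le> exp (- 1/40 :: real) ^ 16" by (intro power_mono) auto
  also have "\<dots> = exp (- 2/5)" using exp_of_nat_mult[of 16 "-1/40::real"] by simp
  finally have "2/3 \<le> exp (- 2/5 :: real)" by (simp add: eval_nat_numeral)
  moreover have "exp (2/5::real) * exp (- 2/5) = 1" by (simp add: exp_add[symmetric])
  ultimately have "exp (2/5::real) * (2/3) \<le> 1"
    by (metis exp_ge_zero mult_left_mono)
  then show ?thesis by simp
qed

lemma g_chart: "g (chart n \<zeta>) = of_real (amp n) * exp \<zeta> * (1 + exp \<zeta> + err n \<zeta>)"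
  using amp_pos[of n] by (simp add: err_def)

lemma norm_err_le:
  assumes "\<bar>Re \<zeta>\<bar> \<le> 2 ^ Suc n * (2/5)"
  shows "cmod (err n \<zeta>) \<le> tail_bound n"
proof -
  let ?N = "2 ^ Suc n :: nat"
  have N: "complex_of_nat ?N = 2 ^ Suc n" by simp
  have x: "\<bar>Re \<zeta> / 2 ^ Suc n\<bar> \<le> 2/5" using assms by (simp add: abs_le_iff field_simps)
  have nz: "cmod (chart n \<zeta>) / 2 ^ (n + 3) = exp (Re \<zeta> / 2 ^ Suc n)" by (simp add: norm_chart)
  have up: "exp (Re \<zeta> / 2 ^ Suc n) \<le> 3/2"
    using x exp_2_5_le by (smt (verit) exp_le_cancel_iff)
  have "exp (- (Re \<zeta> / 2 ^ Suc n)) \<le> 3/2"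
    using x exp_2_5_le by (smt (verit) exp_le_cancel_iff)
  then have low: "2/3 \<le> exp (Re \<zeta> / 2 ^ Suc n)"
    by (simp add: exp_minus divide_simps)
  have "exp (\<zeta> / 2 ^ Suc n) ^ ?N = exp (of_nat ?N * (\<zeta> / 2 ^ Suc n))"
    by (rule exp_of_nat_mult[symmetric])
  also have "of_nat ?N * (\<zeta> / 2 ^ Suc n) = \<zeta>" unfolding N by simp
  finally have E: "exp (\<zeta> / 2 ^ Suc n) ^ ?N = exp \<zeta>" .
  have "chart n \<zeta> / 2 ^ Suc n = 4 * exp (\<zeta> / 2 ^ Suc n)" by (simp add: chart_def power_add)
  then have t0: "(chart n \<zeta> / 2 ^ Suc n) ^ ?N = of_real (amp n) * exp \<zeta>"
    by (simp only: power_mult_distrib E) (simp add: amp_def)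
  have "chart n \<zeta> / 2 ^ Suc (Suc n) = 2 * exp (\<zeta> / 2 ^ Suc n)" by (simp add: chart_def power_add)
  then have "(chart n \<zeta> / 2 ^ Suc (Suc n)) ^ (2 ^ Suc (Suc n)) = ((2 * exp (\<zeta> / 2 ^ Suc n)) ^ 2) ^ ?N"
    by (subst power_mult[symmetric]) simp
  also have "(2 * exp (\<zeta> / 2 ^ Suc n)) ^ 2 = 4 * exp (\<zeta> / 2 ^ Suc n) * exp (\<zeta> / 2 ^ Suc n)"
    by (simp add: power2_eq_square)
  finally have t1: "(chart n \<zeta> / 2 ^ Suc (Suc n)) ^ (2 ^ Suc (Suc n)) = of_real (amp n) * exp \<zeta> * exp \<zeta>"
    by (simp only: power_mult_distrib E) (simp add: amp_def)
  have "term_size n (cmod (chart n \<zeta>)) = cmod (of_real (amp n) * exp \<zeta>)"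
    by (simp only: norm_g_term[symmetric] t0)
  then have "cmod (g (chart n \<zeta>) - of_real (amp n) * exp \<zeta> - of_real (amp n) * exp \<zeta> * exp \<zeta>)
      \<le> tail_bound n * cmod (of_real (amp n) * exp \<zeta>)"
    using norm_g_minus_two_terms[of "chart n \<zeta>" n] low up unfolding nz t0 t1 by simp
  moreover have "g (chart n \<zeta>) - of_real (amp n) * exp \<zeta> - of_real (amp n) * exp \<zeta> * exp \<zeta>
      = (of_real (amp n) * exp \<zeta>) * err n \<zeta>"
    by (simp add: g_chart algebra_simps)
  ultimately have "cmod (of_real (amp n) * exp \<zeta>) * cmod (err n \<zeta>) \<le> cmod (of_real (amp n) * exp \<zeta>) * tail_bound n"
    by (simp only: norm_mult mult.commute[of "tail_bound n"])
  moreover have "cmod (of_real (amp n) * exp \<zeta>) > 0" using amp_pos[of n] by simp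
  ultimately show ?thesis by (simp only: mult_le_cancel_left_pos)
qed

lemma DERIV_g: "(g has_field_derivative deriv g z) (at z)"
  by (rule holomorphic_derivI[OF holomorphic_g open_UNIV UNIV_I])

lemma holomorphic_err: "err n holomorphic_on UNIV"
proof -
  have "chart n holomorphic_on UNIV"
    unfolding chart_def by (intro holomorphic_intros) auto
  then have "(g \<circ> chart n) holomorphic_on UNIV"
    using holomorphic_g holomorphic_on_compose holomorphic_on_subset by blast
  then show ?thesis
    unfolding err_def comp_def using amp_pos[of n] by (intro holomorphic_intros) auto
qed

text \<open>
  Cauchy's estimate on unit discs, which for \<open>n \<ge> 4\<close> fit between the two strips
  because \<open>2^(n+1) / 20 \<ge> 1\<close>.
\<close>

lemma norm_deriv_err_le:
  assumes "\<bar>Re \<zeta>\<bar> \<le> 2 ^ Suc n * (7/20)" "4 \<le> n"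
  shows "cmod (deriv (err n) \<zeta>) \<le> tail_bound n"
proof -
  have "(2::real) ^ 5 \<le> 2 ^ Suc n" using assms by (intro power_increasing) auto
  then have big: "1 + 2 ^ Suc n * (7/20) \<le> 2 ^ Suc n * (2/5 :: real)" by simp
  have "cmod ((deriv ^^ 1) (err n) \<zeta>) \<le> fact 1 * tail_bound n / 1 ^ 1"
  proof (rule Cauchy_inequality)
    show "err n holomorphic_on ball \<zeta> 1" "continuous_on (cball \<zeta> 1) (err n)"
      using holomorphic_err holomorphic_on_imp_continuous_on holomorphic_on_subset by blast+
    fix w assume "cmod (\<zeta> - w) = 1"
    then have "\<bar>Re \<zeta> - Re w\<bar> \<le> 1" using abs_Re_le_cmod[of "\<zeta> - w"] by simp
    then show "cmod (err n w) \<le> tail_bound n" using assms big by (intro norm_err_le) linarith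
  qed simp
  then show ?thesis by simp
qed

text \<open>
  The error term of the derivative: differentiating \<open>exp \<zeta> * (1 + exp \<zeta> + err)\<close> gives
  \<open>exp \<zeta> * (1 + 2 * exp \<zeta> + err + err')\<close>.
\<close>

definition err_plus_deriv :: "nat \<Rightarrow> complex \<Rightarrow> complex" where
  "err_plus_deriv n \<zeta> = err n \<zeta> + deriv (err n) \<zeta>"

lemma norm_err_plus_deriv_le:
  assumes "\<bar>Re \<zeta>\<bar> \<le> 2 ^ Suc n * (7/20)" "4 \<le> n"
  shows "cmod (err_plus_deriv n \<zeta>) \<le> 2 * tail_bound n"
proof -
  have "\<bar>Re \<zeta>\<bar> \<le> 2 ^ Suc n * (2/5)" using assms(1) by (rule order_trans) simp
  then show ?thesis
  unfolding err_plus_deriv_def using norm_deriv_err_le[OF assms] norm_err_le[of \<zeta> n]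
    norm_triangle_ineq[of "err n \<zeta>" "deriv (err n) \<zeta>"] by linarith
qed

lemma DERIV_g_chart:
  "((\<lambda>\<zeta>. g (chart n \<zeta>)) has_field_derivative
     of_real (amp n) * exp \<zeta> * (1 + 2 * exp \<zeta> + err_plus_deriv n \<zeta>)) (at \<zeta>)"
proof -
  have "(err n has_field_derivative deriv (err n) \<zeta>) (at \<zeta>)"
    by (rule holomorphic_derivI[OF holomorphic_err open_UNIV UNIV_I])
  then show ?thesis
    unfolding g_chart err_plus_deriv_def by (auto intro!: derivative_eq_intros simp: algebra_simps)
qed

lemma deriv_g_chart:
  "deriv g (chart n \<zeta>) * (chart n \<zeta> / 2 ^ Suc n) = of_real (amp n) * exp \<zeta> * (1 + 2 * exp \<zeta> + err_plus_deriv n \<zeta>)"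
  using DERIV_chain2[OF DERIV_g DERIV_chart] DERIV_g_chart DERIV_unique by blast

lemma deriv_g_chart_eq_0_iff: "deriv g (chart n \<zeta>) = 0 \<longleftrightarrow> 1 + 2 * exp \<zeta> + err_plus_deriv n \<zeta> = 0"
proof -
  have "of_real (amp n) * exp \<zeta> \<noteq> (0::complex)" "chart n \<zeta> / 2 ^ Suc n \<noteq> 0"
    using chart_nonzero[of n \<zeta>] amp_pos[of n] by auto
  then show ?thesis by (metis deriv_g_chart mult_eq_0_iff)
qed

text \<open>
  At a critical point \<open>w = exp \<zeta>\<close> is close to \<open>-1/2\<close>, where \<open>w * (1 + w) = -1/4\<close>.
\<close>

lemma Re_g_critical:
  assumes "\<bar>Re \<zeta>\<bar> \<le> 2 ^ Suc n * (7/20)" "4 \<le> n" "tail_bound n \<le> 1/100"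
    and "deriv g (chart n \<zeta>) = 0"
  shows "Re (g (chart n \<zeta>)) < 0"
proof -
  define w d e where "w = exp \<zeta>" and "d = err_plus_deriv n \<zeta>" and "e = err n \<zeta>"
  have d: "cmod d \<le> 1/50" using norm_err_plus_deriv_le[OF assms(1,2)] assms(3) by (simp add: d_def)
  have "\<bar>Re \<zeta>\<bar> \<le> 2 ^ Suc n * (2/5)" using assms(1) by (rule order_trans) simp
  then have e: "cmod e \<le> 1/100" using norm_err_le[of \<zeta> n] assms(3) by (simp add: e_def)
  have w: "w = - ((1 + d) / 2)"
    using assms(4) unfolding deriv_g_chart_eq_0_iff w_def d_def by (simp add: field_simps add_eq_0_iff)
  have "w * (1 + w + e) = - 1/4 + (d\<^sup>2 / 4 + w * e)"
    unfolding w by (simp add: power2_eq_square field_simps)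
  moreover have "cmod (d\<^sup>2 / 4 + w * e) \<le> 1/50"
  proof -
    have "cmod (d\<^sup>2 / 4) \<le> (1/50)\<^sup>2 / 4"
      using d by (simp add: norm_divide norm_power power_mono)
    moreover have "cmod w \<le> 1"
      using norm_triangle_ineq[of 1 d] d unfolding w by (simp add: norm_divide)
    then have "cmod (w * e) \<le> 1 * (1/100)"
      unfolding norm_mult using e by (intro mult_mono) auto
    ultimately show ?thesis using norm_triangle_ineq[of "d\<^sup>2 / 4" "w * e"] by (simp add: power2_eq_square)
  qed
  ultimately have "Re (w * (1 + w + e)) < 0"
    using abs_Re_le_cmod[of "d\<^sup>2 / 4 + w * e"] by simp
  moreover have "g (chart n \<zeta>) = of_real (amp n) * (w * (1 + w + e))"
    by (simp add: g_chart w_def e_def)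
  ultimately show ?thesis using amp_pos[of n] by (simp add: mult_pos_neg del: distrib_left)
qed

text \<open>
  On the circle \<open>|w| = 2\<close> the factor \<open>1 + w\<close> stays away from \<open>0\<close>.
\<close>

lemma norm_g_circle_ge:
  assumes "Re \<zeta> = ln 2" "1 \<le> n" "tail_bound n \<le> 1/100"
  shows "real n \<le> cmod (g (chart n \<zeta>))"
proof -
  have "(2::real) ^ 2 \<le> 2 ^ Suc n" using assms by (intro power_increasing) auto
  then have "\<bar>Re \<zeta>\<bar> \<le> 2 ^ Suc n * (2/5)" using assms ln2_le_25_over_36 by (simp add: abs_le_iff)
  then have e: "cmod (err n \<zeta>) \<le> 1/100" using norm_err_le[of \<zeta> n] assms(3) by simp
  have w: "cmod (exp \<zeta>) = 2" using assms by simp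
  have "exp \<zeta> = (1 + exp \<zeta> + err n \<zeta>) - (1 + err n \<zeta>)" by simp
  then have "cmod (exp \<zeta>) \<le> cmod (1 + exp \<zeta> + err n \<zeta>) + cmod (1 + err n \<zeta>)"
    by (metis norm_triangle_ineq4)
  then have "1/2 \<le> cmod (1 + exp \<zeta> + err n \<zeta>)"
    using norm_triangle_ineq[of 1 "err n \<zeta>"] e w by simp
  then have "amp n * 2 * (1/2) \<le> cmod (g (chart n \<zeta>))"
    unfolding g_chart norm_mult w using amp_pos[of n] by (intro mult_mono) auto
  with amp_ge_index[of n] show ?thesis by simp
qed



section \<open>Small balls in the spherical metric\<close>

lemma dist_Fin_0: "dist (Fin 0) (Fin w) = arccos ((1 - (cmod w)\<^sup>2) / (1 + (cmod w)\<^sup>2))"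
  by (simp add: dist_rsphere_def minus_divide_left)

lemma dist_Infty_Fin: "dist Infty (Fin w) = arccos (((cmod w)\<^sup>2 - 1) / (1 + (cmod w)\<^sup>2))"
  by (simp add: dist_rsphere_def)

text \<open>
  A chord is shorter than its arc. This makes \<open>stereo\<close> continuous, so that its inverse, the
  stereographic projection, can be used to compare spherical and Euclidean balls.
\<close>

lemma norm_stereo_diff_le: "norm (stereo x - stereo y) \<le> dist x y"
proof -
  define d where "d = dist x y"
  have bnd: "-1 \<le> stereo x \<bullet> stereo y" "stereo x \<bullet> stereo y \<le> 1"
    using abs_inner_stereo_le[of x y] by (auto simp: abs_le_iff)
  have c: "cos d = stereo x \<bullet> stereo y" unfolding d_def dist_rsphere_def using bnd by simp
  have "(norm (stereo x - stereo y))\<^sup>2 = 2 - 2 * cos d"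
    by (simp add: power2_norm_eq_inner inner_diff_left inner_diff_right inner_stereo_self inner_commute c)
  also have "\<dots> = (2 * sin (d / 2))\<^sup>2"
    using cos_double_sin[of "d / 2"] by (simp add: power2_eq_square)
  finally have "norm (stereo x - stereo y) = \<bar>2 * sin (d / 2)\<bar>"
    by (metis abs_norm_cancel real_sqrt_abs)
  also have "\<dots> \<le> 2 * \<bar>d / 2\<bar>" using abs_sin_x_le_abs_x[of "d / 2"] by (simp add: abs_mult)
  also have "\<dots> = d" by (simp add: d_def)
  finally show ?thesis by (simp add: d_def)
qed

lemma continuous_on_Fin: "continuous_on UNIV Fin"
  unfolding continuous_on_def
proof
  fix a :: complex
  have "((\<lambda>w. stereo (Fin w)) \<longlongrightarrow> stereo (Fin a)) (at a)"
    unfolding stereo.simps by (intro tendsto_intros) (auto simp: add_nonneg_eq_0_iff)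
  then have lim: "((\<lambda>w. stereo (Fin w) \<bullet> stereo (Fin a)) \<longlongrightarrow> 1) (at a)"
    using tendsto_inner[OF _ tendsto_const] inner_stereo_self by metis
  have "((\<lambda>w. arccos (stereo (Fin w) \<bullet> stereo (Fin a))) \<longlongrightarrow> arccos 1) (at a)"
  proof (rule continuous_on_tendsto_compose[OF continuous_on_arccos' lim])
    show "\<forall>\<^sub>F w in at a. stereo (Fin w) \<bullet> stereo (Fin a) \<in> {-1..1}"
      using abs_inner_stereo_le by (auto simp: abs_le_iff minus_le_iff simp del: stereo.simps intro!: always_eventually)
  qed auto
  then show "(Fin \<longlongrightarrow> Fin a) (at a within UNIV)"
    by (subst tendsto_dist_iff) (simp only: dist_rsphere_def arccos_1)
qed

lemma ball_Fin_small:
  assumes "0 < \<delta>"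
  obtains r where "0 < r" "\<And>w. Fin w \<in> ball (Fin a) r \<Longrightarrow> cmod (w - a) < \<delta>"
proof -
  define p where "p = (\<lambda>(u::complex, v::real). u /\<^sub>R (1 - v))"
  have inv: "p (stereo (Fin w)) = w" for w
  proof -
    have "1 + (cmod w)\<^sup>2 \<noteq> 0" by (simp add: add_nonneg_eq_0_iff)
    then have "1 - ((cmod w)\<^sup>2 - 1) / (1 + (cmod w)\<^sup>2) = 2 / (1 + (cmod w)\<^sup>2)" by (simp add: field_simps)
    then have "p (stereo (Fin w)) = (inverse (2 / (1 + (cmod w)\<^sup>2)) * (2 / (1 + (cmod w)\<^sup>2))) *\<^sub>R w"
      by (simp only: p_def stereo.simps prod.case scaleR_scaleR)
    moreover have "inverse (2 / (1 + (cmod w)\<^sup>2)) * (2 / (1 + (cmod w)\<^sup>2)) = 1"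
      using \<open>1 + (cmod w)\<^sup>2 \<noteq> 0\<close> by (intro left_inverse) simp
    ultimately show ?thesis by (simp only: scaleR_one)
  qed
  have ne: "snd (stereo (Fin a)) \<noteq> 1"
  proof -
    have "1 + (cmod a)\<^sup>2 \<noteq> 0" by (simp add: add_nonneg_eq_0_iff)
    then show ?thesis by (simp add: field_simps)
  qed
  have "isCont p (stereo (Fin a))"
    unfolding p_def case_prod_beta by (intro continuous_intros) (use ne in auto)
  then obtain d where d: "0 < d" "\<And>y. dist y (stereo (Fin a)) < d \<Longrightarrow> dist (p y) (p (stereo (Fin a))) < \<delta>"
    using assms unfolding continuous_at_eps_delta by blast
  show thesis
  proof
    fix w assume "Fin w \<in> ball (Fin a) d"
    then have "dist (stereo (Fin w)) (stereo (Fin a)) < d"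
      using norm_stereo_diff_le[of "Fin w" "Fin a"] by (simp only: dist_norm mem_ball dist_commute)
    from d(2)[OF this] show "cmod (w - a) < \<delta>" by (simp only: inv dist_norm)
  qed (fact d)
qed

text \<open>
  The spherical distance from \<open>0\<close> to \<open>w\<close> is \<open>2 * arctan |w|\<close>.
\<close>

lemma Fin_in_ball_0_iff:
  assumes "0 < r" "r < pi"
  shows "Fin w \<in> ball (Fin 0) r \<longleftrightarrow> cmod w < tan (r / 2)"
proof -
  define s where "s = cmod w"
  define q where "q = tan (r / 2)"
  have c: "cos (r / 2) > 0" using assms by (intro cos_gt_zero_pi) auto
  have q: "q > 0" unfolding q_def using assms by (intro tan_gt_zero) auto
  have p: "1 + s\<^sup>2 > 0" "1 + q\<^sup>2 > 0" by (auto intro: add_pos_nonneg)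
  have "cos r = (1 - q\<^sup>2) / (1 + q\<^sup>2)"
  proof -
    have *: "(sin (r/2))\<^sup>2 = q\<^sup>2 * (cos (r/2))\<^sup>2" using c by (simp add: q_def tan_def power_divide)
    have "(1 + q\<^sup>2) * (cos (r/2))\<^sup>2 = 1" using * sin_cos_squared_add[of "r/2"] by (simp add: algebra_simps)
    then have "(cos (r/2))\<^sup>2 = 1 / (1 + q\<^sup>2)" using p by (simp add: field_simps)
    moreover have "cos r = (1 - q\<^sup>2) * (cos (r/2))\<^sup>2" using * cos_double[of "r/2"] by (simp add: algebra_simps)
    ultimately show ?thesis by simp
  qed
  have rng: "\<bar>(1 - s\<^sup>2) / (1 + s\<^sup>2)\<bar> \<le> 1" using p by (simp add: abs_le_iff field_simps)
  have "Fin w \<in> ball (Fin 0) r \<longleftrightarrow> arccos ((1 - s\<^sup>2) / (1 + s\<^sup>2)) < arccos (cos r)"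
    using assms unfolding mem_ball dist_Fin_0 s_def by (simp add: arccos_cos)
  also have "\<dots> \<longleftrightarrow> cos r < (1 - s\<^sup>2) / (1 + s\<^sup>2)"
    using rng by (intro arccos_less_mono) auto
  also have "\<dots> \<longleftrightarrow> s\<^sup>2 < q\<^sup>2"
    unfolding \<open>cos r = _\<close> using p by (simp add: field_simps)
  also have "\<dots> \<longleftrightarrow> s < q"
    using q by (auto simp: s_def intro: power2_less_imp_less power_strict_mono)
  finally show ?thesis by (simp add: s_def q_def)
qed

lemma Fin_tendsto_Infty:
  assumes "filterlim (\<lambda>t. cmod (f t)) at_top F"
  shows "((\<lambda>t. Fin (f t)) \<longlongrightarrow> Infty) F"
proof -
  have "((\<lambda>s::real. (s\<^sup>2 - 1) / (1 + s\<^sup>2)) \<longlongrightarrow> 1) at_top" by real_asymp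
  then have lim: "((\<lambda>t. ((cmod (f t))\<^sup>2 - 1) / (1 + (cmod (f t))\<^sup>2)) \<longlongrightarrow> 1) F"
    using assms by (rule filterlim_compose)
  have "((\<lambda>t. arccos (((cmod (f t))\<^sup>2 - 1) / (1 + (cmod (f t))\<^sup>2))) \<longlongrightarrow> arccos 1) F"
  proof (rule continuous_on_tendsto_compose[OF continuous_on_arccos' lim])
    have "((cmod w)\<^sup>2 - 1) / (1 + (cmod w)\<^sup>2) \<in> {-1..1}" for w
      using add_pos_nonneg[of 1 "(cmod w)\<^sup>2"] by (simp add: field_simps)
    then show "\<forall>\<^sub>F t in F. ((cmod (f t))\<^sup>2 - 1) / (1 + (cmod (f t))\<^sup>2) \<in> {-1..1}"
      by (intro always_eventually) blast
  qed auto
  then show ?thesis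
    by (subst tendsto_dist_iff) (simp only: dist_commute[of _ Infty] dist_Infty_Fin arccos_1)
qed

lemma ball_Infty_small:
  obtains r where "0 < r" "\<And>w. Fin w \<in> ball Infty r \<Longrightarrow> M < cmod w"
proof -
  define x where "x = ((max 0 M)\<^sup>2 - 1) / (1 + (max 0 M)\<^sup>2)"
  have p: "1 + s\<^sup>2 > 0" for s :: real by (auto intro: add_pos_nonneg)
  have x: "-1 \<le> x" "x < 1" using p[of "max 0 M"] by (auto simp: x_def field_simps)
  show thesis
  proof
    show "0 < arccos x" using arccos_less_arccos[of x 1] x by simp
    fix w assume "Fin w \<in> ball Infty (arccos x)"
    then have "arccos (((cmod w)\<^sup>2 - 1) / (1 + (cmod w)\<^sup>2)) < arccos x"
      by (simp only: mem_ball dist_Infty_Fin)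
    moreover have "\<bar>((cmod w)\<^sup>2 - 1) / (1 + (cmod w)\<^sup>2)\<bar> \<le> 1" using p[of "cmod w"] by (simp add: abs_le_iff field_simps)
    ultimately have "x < ((cmod w)\<^sup>2 - 1) / (1 + (cmod w)\<^sup>2)"
      using arccos_less_mono[of "((cmod w)\<^sup>2 - 1) / (1 + (cmod w)\<^sup>2)" x] x by simp
    then have "(max 0 M)\<^sup>2 < (cmod w)\<^sup>2"
      unfolding x_def using p[of "max 0 M"] p[of "cmod w"] by (simp add: field_simps)
    then have "max 0 M < cmod w" by (rule power2_less_imp_less) simp
    then show "M < cmod w" by simp
  qed
qed

section \<open>Transcendental singularities and curves to infinity\<close>

text \<open>
  If some \<open>U r\<close> were bounded, the closures of the \<open>U s\<close>, \<open>s < r\<close>, would be compact and nested. Each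
  closure is contained in every larger \<open>U t\<close>, since \<open>f\<close> maps it into the closed ball of radius \<open>s\<close>.
  Their common point would lie in all \<open>U t\<close>.
\<close>

lemma transcendental_singularity_unbounded:
  assumes f: "continuous_on UNIV f" and U: "transcendental_singularity f a U" and r: "0 < r"
  shows "\<not> bounded (U r)"
proof
  assume bdd: "bounded (U r)"
  have cont: "continuous_on UNIV (\<lambda>z. Fin (f z))"
    using continuous_on_compose2[OF continuous_on_Fin f] by simp
  have comp: "U s \<in> components {z. Fin (f z) \<in> ball a s}" if "0 < s" for s
    using U that by (simp add: transcendental_singularity_def)
  have mono: "U s \<subseteq> U t" if "0 < s" "s < t" for s t
    using U that by (simp add: transcendental_singularity_def)
  have cl: "closure (U s) \<subseteq> U t" if st: "0 < s" "s < t" for s t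
  proof (rule components_maximal[OF comp[of t]])
    show "connected (closure (U s))"
      using comp[OF st(1)] by (intro connected_imp_connected_closure in_components_connected)
    have "closed {z. Fin (f z) \<in> cball a s}"
      using continuous_closed_vimage[OF closed_cball, of "\<lambda>z. Fin (f z)" a s] cont
      by (simp add: vimage_def continuous_on_eq_continuous_at)
    moreover have "U s \<subseteq> {z. Fin (f z) \<in> cball a s}"
      using in_components_subset[OF comp[OF st(1)]] by auto
    ultimately have "closure (U s) \<subseteq> {z. Fin (f z) \<in> cball a s}"
      by (rule closure_minimal[rotated])
    then show "closure (U s) \<subseteq> {z. Fin (f z) \<in> ball a t}" using st by auto
    show "U t \<inter> closure (U s) \<noteq> {}"
      using in_components_nonempty[OF comp[OF st(1)]] mono[OF st] closure_subset[of "U s"] by blast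
  qed (use st in auto)
  define s where "s n = r / (real n + 2)" for n
  have s: "0 < s n" "s n < r" for n using r by (auto simp: s_def field_simps intro: add_pos_nonneg)
  have "\<Inter>(range (\<lambda>n. closure (U (s n)))) \<noteq> {}"
  proof (rule compact_nest)
    fix n
    show "compact (closure (U (s n)))"
      using bounded_subset[OF bdd mono[OF s]] by (simp add: compact_closure)
    show "closure (U (s n)) \<noteq> {}"
      using in_components_nonempty[OF comp[OF s(1)]] by simp
  next
    fix m n :: nat assume "m \<le> n"
    show "closure (U (s n)) \<subseteq> closure (U (s m))"
    proof (cases "m = n")
      case False
      then have "s n < s m" using \<open>m \<le> n\<close> r by (auto simp: s_def intro!: divide_strict_left_mono)
      then show ?thesis using mono[OF s(1)] closure_mono by blast
    qed simp
  qed
  then obtain z where z: "\<And>n. z \<in> closure (U (s n))" by blast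
  have "z \<in> U t" if "0 < t" for t
  proof -
    obtain n :: nat where "r / t < real n" using reals_Archimedean2 by blast
    then have "s n < t" using \<open>0 < t\<close> r by (simp add: s_def field_simps)
    then show ?thesis using cl[OF s(1)] z by blast
  qed
  then have "(\<Inter>r\<in>{0<..}. U r) \<noteq> {}" by blast
  then show False using U by (simp add: transcendental_singularity_def)
qed

lemma unbounded_connected_meets_spheres:
  fixes C :: "complex set"
  assumes "connected C" "\<not> bounded C" "z \<in> C" "cmod z \<le> R"
  shows "\<exists>w\<in>C. cmod w = R"
proof -
  obtain y where y: "y \<in> C" "R < cmod y"
    using assms(2) unfolding bounded_iff by (meson not_le)
  have "connected (cmod ` C)"
    using assms(1) by (intro connected_continuous_image continuous_intros)
  then have "R \<in> cmod ` C"
    using connectedD_interval[of "cmod ` C" "cmod z" "cmod y" R] assms(3,4) y by auto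
  then show ?thesis by auto
qed

text \<open>
  The component containing a final piece of the curve \<open>\<gamma>\<close>. Quantifying over all late times, instead of
  choosing a starting time for each \<open>r\<close>, makes monotonicity in \<open>r\<close> and emptiness for \<open>r \<le> 0\<close> immediate.
\<close>

definition tract :: "(complex \<Rightarrow> complex) \<Rightarrow> rsphere \<Rightarrow> (real \<Rightarrow> complex) \<Rightarrow> real \<Rightarrow> complex set" where
  "tract f a \<gamma> r = {z. \<forall>\<^sub>F t in at_top. connected_component {z. Fin (f z) \<in> ball a r} z (\<gamma> t)}"

lemma tract_eq_component:
  assumes \<gamma>: "continuous_on UNIV \<gamma>" and in_S: "\<And>t. t0 \<le> t \<Longrightarrow> Fin (f (\<gamma> t)) \<in> ball a r"
  shows "tract f a \<gamma> r = connected_component_set {z. Fin (f z) \<in> ball a r} (\<gamma> t0)"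
proof -
  let ?S = "{z. Fin (f z) \<in> ball a r}"
  have conn: "connected_component ?S (\<gamma> t0) (\<gamma> t)" if "t0 \<le> t" for t
    unfolding connected_component_def
  proof (intro exI conjI)
    show "connected (\<gamma> ` {t0..t})"
      using \<gamma> by (intro connected_continuous_image connected_Icc continuous_on_subset[OF \<gamma>]) auto
  qed (use in_S that in auto)
  show ?thesis
  proof (intro set_eqI iffI)
    fix z assume "z \<in> tract f a \<gamma> r"
    then have "\<forall>\<^sub>F t in at_top. connected_component ?S z (\<gamma> t) \<and> t0 \<le> t"
      unfolding tract_def by (auto intro: eventually_conj eventually_ge_at_top)
    then obtain t where "connected_component ?S z (\<gamma> t)" "t0 \<le> t"
      using eventually_happens'[OF trivial_limit_at_top_linorder] by blast
    with conn[of t] show "z \<in> connected_component_set ?S (\<gamma> t0)"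
      by (auto intro: connected_component_trans connected_component_sym)
  next
    fix z assume "z \<in> connected_component_set ?S (\<gamma> t0)"
    then have "connected_component ?S z (\<gamma> t)" if "t0 \<le> t" for t
      using conn[OF that] by (auto intro: connected_component_trans connected_component_sym)
    then show "z \<in> tract f a \<gamma> r"
      unfolding tract_def by (auto intro: eventually_mono[OF eventually_ge_at_top[of t0]])
  qed
qed

lemma tract_component:
  assumes \<gamma>: "continuous_on UNIV \<gamma>" and lim: "((\<lambda>t. Fin (f (\<gamma> t))) \<longlongrightarrow> a) at_top" and r: "0 < r"
  shows "tract f a \<gamma> r \<in> components {z. Fin (f z) \<in> ball a r}"
    and "\<forall>\<^sub>F t in at_top. \<gamma> t \<in> tract f a \<gamma> r"
proof -
  have "\<forall>\<^sub>F t in at_top. Fin (f (\<gamma> t)) \<in> ball a r"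
    using tendstoD[OF lim r] by (simp add: dist_commute)
  then obtain t0 where t0: "\<And>t. t0 \<le> t \<Longrightarrow> Fin (f (\<gamma> t)) \<in> ball a r"
    unfolding eventually_at_top_linorder by blast
  show "tract f a \<gamma> r \<in> components {z. Fin (f z) \<in> ball a r}"
    using componentsI[of "\<gamma> t0" "{z. Fin (f z) \<in> ball a r}"] t0[of t0]
      tract_eq_component[OF \<gamma>, of t0 f a r, OF t0] by simp
  show "\<forall>\<^sub>F t in at_top. \<gamma> t \<in> tract f a \<gamma> r"
    unfolding eventually_at_top_linorder
  proof (intro exI allI impI)
    fix t assume "t0 \<le> t"
    then have "tract f a \<gamma> r = connected_component_set {z. Fin (f z) \<in> ball a r} (\<gamma> t)"
      by (intro tract_eq_component \<gamma> t0) simp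
    then show "\<gamma> t \<in> tract f a \<gamma> r" using t0[OF \<open>t0 \<le> t\<close>] by simp
  qed
qed

text \<open>
  Over infinity both directness and the empty intersection are automatic: \<open>f z\<close> is finite, hence
  at positive distance from infinity.
\<close>

lemma direct_singularity_over_Infty:
  assumes \<gamma>: "continuous_on UNIV \<gamma>" and lim: "((\<lambda>t. Fin (f (\<gamma> t))) \<longlongrightarrow> Infty) at_top"
  shows "direct_singularity f Infty (tract f Infty \<gamma>)"
proof -
  let ?S = "\<lambda>r. {z. Fin (f z) \<in> ball Infty r}"
  have sub: "tract f Infty \<gamma> r \<subseteq> ?S r" for r
  proof
    fix z assume "z \<in> tract f Infty \<gamma> r"
    then obtain t where "connected_component (?S r) z (\<gamma> t)"
      using eventually_happens'[OF trivial_limit_at_top_linorder] unfolding tract_def by blast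
    then show "z \<in> ?S r" using connected_component_in by fastforce
  qed
  have "tract f Infty \<gamma> r1 \<subseteq> tract f Infty \<gamma> r2" if "r1 < r2" for r1 r2
  proof
    fix z assume "z \<in> tract f Infty \<gamma> r1"
    then have "\<forall>\<^sub>F t in at_top. connected_component (?S r1) z (\<gamma> t)"
      by (simp only: tract_def mem_Collect_eq)
    moreover have "?S r1 \<subseteq> ?S r2" using that by auto
    then have "connected_component (?S r2) z y" if "connected_component (?S r1) z y" for y
      using connected_component_mono that by blast
    ultimately have "\<forall>\<^sub>F t in at_top. connected_component (?S r2) z (\<gamma> t)"
      by (rule eventually_mono)
    then show "z \<in> tract f Infty \<gamma> r2" by (simp only: tract_def mem_Collect_eq)
  qed
  moreover have "tract f Infty \<gamma> r = {}" if "r \<le> 0" for r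
  proof -
    have "?S r = {}" using that by (simp add: ball_empty)
    then show ?thesis using sub[of r] by simp
  qed
  moreover have "(\<Inter>r\<in>{0<..}. tract f Infty \<gamma> r) = {}"
  proof -
    have "z \<notin> tract f Infty \<gamma> (dist Infty (Fin (f z)))" for z
      using sub by auto
    then show ?thesis by (force simp: zero_less_dist_iff)
  qed
  ultimately have "transcendental_singularity f Infty (tract f Infty \<gamma>)"
    unfolding transcendental_singularity_def using tract_component(1)[OF \<gamma> lim] by simp
  then show ?thesis unfolding direct_singularity_def by (auto intro: exI[of _ 1])
qed



section \<open>Critical values and nonzero finite values of h\<close>

lemma holomorphic_h: "h holomorphic_on UNIV"
  unfolding h_def using holomorphic_g by (intro holomorphic_intros)

lemma continuous_on_h: "continuous_on S h"
  using holomorphic_h holomorphic_on_imp_continuous_on holomorphic_on_subset by blast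

lemma norm_h: "cmod (h z) = exp (Re (g z))" by (simp add: h_def)

lemma deriv_h_eq_0_iff: "deriv h z = 0 \<longleftrightarrow> deriv g z = 0"
proof -
  have "(h has_field_derivative exp (g z) * deriv g z) (at z)"
    unfolding h_def using DERIV_g by (auto intro!: derivative_eq_intros)
  then show ?thesis by (simp add: DERIV_imp_deriv)
qed

text \<open>
  A polynomial without zeros is constant, but \<open>|h 0| = 1 < |h 1|\<close>.
\<close>

lemma transcendental_entire_h: "transcendental_entire h"
proof -
  have "\<not> (\<forall>z. h z = poly p z)" for p
  proof
    assume p: "\<forall>z. h z = poly p z"
    have "poly p z = exp (g z)" for z
      using p[rule_format, of z] unfolding h_def by (rule sym)
    then have "poly p z \<noteq> 0" for z by simp
    then obtain a where "p = [:a:]"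
      using fundamental_theorem_of_algebra_alt[of p] by blast
    then have "h 1 = h 0" using p by simp
    moreover have "g 0 = 0" by (simp add: g_def power_0_left)
    ultimately have "exp (Re (g 1)) = 1" using norm_h[of 0] norm_h[of 1] by simp
    moreover have "Re (g 1) = (\<Sum>k. Re ((1 / 2 ^ Suc k) ^ (2 ^ Suc k)))"
      unfolding g_def by (rule Re_suminf[OF summable_g])
    moreover have "0 < \<dots>"
    proof (rule suminf_pos)
      have eq: "(1 / 2 ^ Suc k :: complex) ^ (2 ^ Suc k) = complex_of_real ((1 / 2 ^ Suc k) ^ (2 ^ Suc k))" for k
        by (simp only: of_real_power of_real_divide of_real_1 of_real_numeral)
      show "0 < Re ((1 / 2 ^ Suc k) ^ (2 ^ Suc k))" for k
        unfolding eq Re_complex_of_real by (intro zero_less_power) simp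
      show "summable (\<lambda>k. Re ((1 / 2 ^ Suc k) ^ (2 ^ Suc k)))"
        by (rule summable_Re[OF summable_g])
    qed
    ultimately show False by simp
  qed
  then show ?thesis using holomorphic_h by (simp add: transcendental_entire_def)
qed

lemma bounded_critical_values_h: "bounded (critical_values h)"
proof -
  obtain m where m: "\<And>n. m \<le> n \<Longrightarrow> tail_bound n \<le> 1/100"
    using eventually_tail_bound_le unfolding eventually_sequentially by blast
  define R where "R = (2::real) ^ (max m 4 + 4)"
  have "cmod (h z) \<le> 1" if crit: "deriv h z = 0" and z: "R < cmod z" for z
  proof -
    have "2 ^ (max m 4 + 4) \<le> cmod z" using z unfolding R_def by simp
    then obtain n \<zeta> where n: "max m 4 \<le> n" "\<bar>Re \<zeta>\<bar> \<le> 2 ^ Suc n * (7/20)" "chart n \<zeta> = z"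
      by (rule exists_chart_eq)
    then have "Re (g (chart n \<zeta>)) < 0"
      using crit m[of n] unfolding deriv_h_eq_0_iff by (intro Re_g_critical) auto
    then show ?thesis by (simp add: norm_h n)
  qed
  moreover have "bounded (h ` cball 0 R)"
    by (intro compact_imp_bounded compact_continuous_image continuous_on_h compact_cball)
  then obtain B where B: "\<And>z. z \<in> cball 0 R \<Longrightarrow> cmod (h z) \<le> B"
    unfolding bounded_iff by blast
  ultimately have "cmod (h z) \<le> max 1 B" if "deriv h z = 0" for z
    using that B[of z] by (cases "R < cmod z") (auto simp: le_max_iff_disj)
  then show ?thesis unfolding critical_values_def bounded_iff by blast
qed

text \<open>
  On a connected set where \<open>h\<close> is close to \<open>a\<close>, the principal branch of \<open>log (h / a)\<close> is defined and
  bounded. It differs from \<open>g\<close> by a continuous function with values in the logarithms of \<open>a\<close>,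
  hence by a constant. So \<open>g\<close> is bounded there, whereas \<open>|g|\<close> is large on a
  sequence of circles that an unbounded connected set would have to cross.
\<close>

lemma bounded_where_h_near_nonzero:
  assumes "a \<noteq> 0"
  obtains r where "0 < r"
    "\<And>C. connected C \<Longrightarrow> C \<subseteq> {z. Fin (h z) \<in> ball (Fin a) r} \<Longrightarrow> bounded C"
proof -
  obtain r where r: "0 < r" "\<And>w. Fin w \<in> ball (Fin a) r \<Longrightarrow> cmod (w - a) < cmod a / 2"
    using ball_Fin_small[of "cmod a / 2" a] assms by auto
  show thesis
  proof (rule that[OF r(1)])
    fix C assume C: "connected C" "C \<subseteq> {z. Fin (h z) \<in> ball (Fin a) r}"
    define u where "u z = (h z - a) / a" for z
    have u: "cmod (u z) < 1/2" if "z \<in> C" for z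
    proof -
      have "cmod (h z - a) < cmod a / 2" using r(2) C(2) that by blast
      then show ?thesis using assms by (simp add: u_def norm_divide field_simps)
    qed
    define \<phi> where "\<phi> z = g z - Ln (1 + u z)" for z
    have nz: "1 + u z \<notin> \<real>\<^sub>\<le>\<^sub>0" if "z \<in> C" for z
      using u[OF that] abs_Re_le_cmod[of "u z"] by (auto simp: complex_nonpos_Reals_iff)
    have "\<phi> constant_on C"
    proof (rule continuous_discrete_range_constant[OF C(1)])
      show "continuous_on C \<phi>"
        unfolding \<phi>_def u_def using nz assms
        by (intro continuous_intros continuous_on_g continuous_on_h) (auto simp: u_def)
      have e: "exp (\<phi> z) = a" if "z \<in> C" for z
      proof -
        have "1 + u z \<noteq> 0" using nz[OF that] by auto
        then have "exp (\<phi> z) = h z / (1 + u z)" by (simp add: \<phi>_def exp_diff h_def)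
        moreover have "h z = a * (1 + u z)" using assms by (simp add: u_def field_simps)
        ultimately show ?thesis using \<open>1 + u z \<noteq> 0\<close> by simp
      qed
      show "\<exists>e>0. \<forall>y. y \<in> C \<and> \<phi> y \<noteq> \<phi> x \<longrightarrow> e \<le> norm (\<phi> y - \<phi> x)" if "x \<in> C" for x
      proof (intro exI[of _ "2 * pi"] conjI allI impI)
        fix y assume y: "y \<in> C \<and> \<phi> y \<noteq> \<phi> x"
        then have "exp (\<phi> y) = exp (\<phi> x)" using e that by simp
        then obtain k :: int where k: "\<phi> y = \<phi> x + (of_int (2 * k) * pi) * \<i>"
          unfolding exp_eq by blast
        with y have "k \<noteq> 0" by auto
        then have "1 \<le> \<bar>real_of_int k\<bar>" by simp
        then have "2 * pi * 1 \<le> 2 * pi * \<bar>real_of_int k\<bar>" by (intro mult_left_mono) auto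
        also have "\<dots> = cmod (\<phi> y - \<phi> x)" unfolding k by (simp add: norm_mult)
        finally show "2 * pi \<le> norm (\<phi> y - \<phi> x)" by simp
      qed simp
    qed
    then obtain c where c: "\<And>z. z \<in> C \<Longrightarrow> \<phi> z = c" unfolding constant_on_def by blast
    have gb: "cmod (g z) \<le> cmod c + 1" if "z \<in> C" for z
    proof -
      have "g z = c + Ln (1 + u z)" using c[OF that] by (simp add: \<phi>_def algebra_simps)
      moreover have "cmod (Ln (1 + u z)) \<le> 1"
        using norm_Ln_le[OF u[OF that]] u[OF that] by simp
      ultimately show ?thesis using norm_triangle_ineq[of c "Ln (1 + u z)"] by simp
    qed
    show "bounded C"
    proof (rule ccontr)
      assume unb: "\<not> bounded C"
      then obtain z where z: "z \<in> C" by fastforce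
      obtain n0 :: nat where n0: "cmod c + 1 + cmod z < real n0" using reals_Archimedean2 by blast
      obtain n where n: "1 \<le> n" "n0 \<le> n" "tail_bound n \<le> 1/100"
        using eventually_happens'[OF _ eventually_conj[OF eventually_tail_bound_le
              eventually_ge_at_top[of "max 1 n0"]]] by auto
      have "cmod z \<le> real n" using n0 n norm_ge_zero[of c] by linarith
      also have "\<dots> \<le> 2 ^ n" using less_exp[of n] by (simp add: less_imp_le)
      also have "\<dots> * 1 \<le> 2 ^ (n + 3) * exp (ln 2 / 2 ^ Suc n)"
        by (intro mult_mono power_increasing) auto
      finally obtain w where w: "w \<in> C" "cmod w = 2 ^ (n + 3) * exp (ln 2 / 2 ^ Suc n)"
        using unbounded_connected_meets_spheres[OF C(1) unb z] by auto
      from w(2) obtain \<zeta> where "Re \<zeta> = ln 2" "chart n \<zeta> = w" by (rule chart_surj)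
      then have "real n \<le> cmod (g w)" using norm_g_circle_ge n by metis
      then show False using gb[OF w(1)] n0 n(2) norm_ge_zero[of z] by linarith
    qed
  qed
qed



section \<open>Critical points in the preimages of left half-planes\<close>

text \<open>
  The identity \<open>w * (1 + w) = (w + 1/2)\<^sup>2 - 1/4\<close> bounds the real part by \<open>1/16 - 1/4\<close> up to the error.
\<close>

lemma Re_g_less_near_minus_half:
  assumes n: "4 \<le> n" "tail_bound n \<le> 1/100" "32 * \<bar>L\<bar> < amp n"
    and \<zeta>: "\<bar>Re \<zeta>\<bar> \<le> 2" "cmod (exp \<zeta> + 1/2) \<le> 1/4"
  shows "Re (g (chart n \<zeta>)) < L"
proof -
  define w e where "w = exp \<zeta>" and "e = err n \<zeta>"
  have "(32::real) \<le> 2 ^ Suc n" using power_increasing[of 5 "Suc n" "2::real"] n by simp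
  then have "\<bar>Re \<zeta>\<bar> \<le> 2 ^ Suc n * (2/5)" using \<zeta> by simp
  then have e: "cmod e \<le> 1/100" using norm_err_le[of \<zeta> n] n by (simp add: e_def)
  have "w * (1 + w + e) = - 1/4 + ((w + 1/2)\<^sup>2 + w * e)"
    by (simp add: power2_eq_square field_simps)
  moreover have "cmod ((w + 1/2)\<^sup>2 + w * e) \<le> 1/16 + 1/100"
  proof -
    have "cmod ((w + 1/2)\<^sup>2) \<le> (1/4)\<^sup>2"
      unfolding norm_power using \<zeta>(2) by (intro power_mono) (auto simp: w_def)
    moreover have "cmod w \<le> 1"
    proof -
      have "cmod w \<le> cmod (w + 1/2) + 1/2"
        using norm_triangle_ineq4[of "w + 1/2" "1/2"] by simp
      then show ?thesis using \<zeta>(2) unfolding w_def by linarith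
    qed
    then have "cmod (w * e) \<le> 1 * (1/100)"
      unfolding norm_mult using e by (intro mult_mono) auto
    ultimately show ?thesis using norm_triangle_ineq[of "(w + 1/2)\<^sup>2" "w * e"] by (simp add: power2_eq_square)
  qed
  ultimately have "Re (w * (1 + w + e)) \<le> - 1/32"
    using abs_Re_le_cmod[of "(w + 1/2)\<^sup>2 + w * e"] by simp
  moreover have "g (chart n \<zeta>) = of_real (amp n) * (w * (1 + w + e))"
    by (simp add: g_chart w_def e_def)
  then have "Re (g (chart n \<zeta>)) = amp n * Re (w * (1 + w + e))"
    by (simp only: Re_complex_of_real Im_complex_of_real times_complex.sel)
  ultimately have "Re (g (chart n \<zeta>)) \<le> amp n * (- 1/32)"
    using amp_pos[of n] by (simp only: mult_le_cancel_left_pos)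
  with n(3) show ?thesis by simp
qed

text \<open>
  On the circle \<open>|w| = 1/4\<close>, parametrised by the angle \<open>t\<close> between \<open>w\<close> and the negative axis, the
  main term of \<open>Re g / amp n\<close> is \<open>- cos t / 4 + cos (2 * t) / 16\<close>. For \<open>cos t \<ge> 0\<close> it is at most
  \<open>-1/16\<close>, so the claim holds there without reference to \<open>t0\<close>. Otherwise the bound at
  \<open>t0\<close> forces \<open>- 1/2 < cos t0\<close>, and on \<open>{t..t0}\<close> the derivative
  \<open>sin x * (1 - cos x) / 4\<close> of the main term exceeds the error, so \<open>Re g\<close> decreases
  from \<open>t0\<close> to \<open>t\<close>. The sign \<open>s\<close> covers both half-circles.
\<close>

lemma Re_g_less_along_arc:
  fixes m s :: real
  defines "\<zeta> \<equiv> \<lambda>t::real. Complex (- ln 4) (m + s * t)"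
  assumes n: "4 \<le> n" "tail_bound n \<le> 1/100" "32 * \<bar>L\<bar> < amp n"
    and m: "cis m = - 1" and s: "s = 1 \<or> s = -1"
    and t: "0 \<le> t" "t \<le> t0" "t0 \<le> pi" and t0: "Re (g (chart n (\<zeta> t0))) < L"
  shows "Re (g (chart n (\<zeta> t))) < L"
proof -
  define A where "A = amp n"
  have A: "A > 0" "32 * \<bar>L\<bar> < A" using amp_pos n by (auto simp: A_def)
  define w where "w x = exp (\<zeta> x)" for x
  have w: "w x = - cis (s * x) / 4" for x
  proof -
    have "w x = of_real (exp (- ln 4)) * (cis m * cis (s * x))"
      by (simp add: w_def \<zeta>_def exp_eq_polar cis_mult)
    then show ?thesis using m by (simp add: exp_minus)
  qed
  have nw: "cmod (w x) = 1/4" for x by (simp add: w norm_divide)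
  have "(32::real) \<le> 2 ^ Suc n" using power_increasing[of 5 "Suc n" "2::real"] n by simp
  have ln4: "ln (4::real) = 2 * ln 2" using ln_realpow[of 2 2] by simp
  have le_2: "\<bar>Re (\<zeta> x)\<bar> \<le> 2" for x
    using ln2_le_25_over_36 ln_gt_zero[of "2::real"] unfolding \<zeta>_def complex.sel ln4 by linarith
  have range: "\<bar>Re (\<zeta> x)\<bar> \<le> 2 ^ Suc n * (7/20)" for x
    using le_2[of x] \<open>32 \<le> 2 ^ Suc n\<close> by linarith
  have range': "\<bar>Re (\<zeta> x)\<bar> \<le> 2 ^ Suc n * (2/5)" for x
    using range[of x] by (rule order_trans) simp
  have e: "cmod (err n (\<zeta> x)) \<le> 1/100" for x using norm_err_le[OF range', of x] n by simp
  have d: "cmod (err_plus_deriv n (\<zeta> x)) \<le> 1/50" for x using norm_err_plus_deriv_le[OF range n(1), of x] n by simp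
  define f where "f x = Re (g (chart n (\<zeta> x)))" for x
  define q where "q x = - cos x / 4 + cos (2 * x) / 16" for x :: real
  have cs: "cos (s * x) = cos x" "sin (s * x) = s * sin x" for x using s by auto
  have w2: "(w x)\<^sup>2 = cis (s * (2 * x)) / 16" for x
    by (simp add: w power2_eq_square cis_mult algebra_simps)
  have f: "\<bar>f x - A * q x\<bar> \<le> A / 400" for x
  proof -
    have "g (chart n (\<zeta> x)) = of_real A * (w x + (w x)\<^sup>2 + w x * err n (\<zeta> x))"
      by (simp add: g_chart w_def A_def power2_eq_square algebra_simps)
    then have "f x = A * Re (w x + (w x)\<^sup>2 + w x * err n (\<zeta> x))"
      unfolding f_def by (simp only: Re_complex_of_real Im_complex_of_real times_complex.sel)
    also have "Re (w x + (w x)\<^sup>2 + w x * err n (\<zeta> x)) = q x + Re (w x * err n (\<zeta> x))"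
      unfolding w2 plus_complex.sel by (simp add: w q_def cs)
    finally have "f x - A * q x = A * Re (w x * err n (\<zeta> x))" by (simp add: algebra_simps)
    moreover have "\<bar>Re (w x * err n (\<zeta> x))\<bar> \<le> 1/400"
      using abs_Re_le_cmod[of "w x * err n (\<zeta> x)"] e[of x] by (simp only: norm_mult nw)
    ultimately show ?thesis using A mult_left_mono[of "\<bar>Re (w x * err n (\<zeta> x))\<bar>" "1/400" A]
      by (simp add: abs_mult)
  qed
  show ?thesis
  proof (cases "0 \<le> cos t")
    case True
    have "(cos t)\<^sup>2 \<le> cos t" using True mult_left_mono[of "cos t" 1 "cos t"] by (simp add: power2_eq_square)
    then have "- cos t / 4 + (2 * (cos t)\<^sup>2 - 1) / 16 \<le> - 1/16" using True by (simp add: field_simps)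
    then have "q t \<le> -1/16" by (simp only: q_def cos_double_cos)
    then have "A * q t \<le> A * (-1/16)" using A by (intro mult_left_mono) auto
    then have "f t \<le> A * (-1/16) + A / 400" using f[of t] by linarith
    then show ?thesis using A unfolding f_def by linarith
  next
    case False
    have "f t0 < L" using t0 by (simp add: f_def)
    then have "A * q t0 < A / 32 + A / 400" using f[of t0] A by linarith
    then have "A * q t0 < A * (1/32 + 1/400)" by (simp add: field_simps)
    then have "q t0 < 1/32 + 1/400" using A by (simp only: mult_less_cancel_left_pos)
    have c0: "- 1/2 < cos t0"
    proof (rule ccontr)
      define y where "y = - cos t0"
      assume "\<not> - 1/2 < cos t0"
      then have "1/2 \<le> y" by (simp add: y_def)
      then have "(1/2)\<^sup>2 \<le> y\<^sup>2" by (intro power_mono) auto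
      then have "1/4 \<le> y\<^sup>2" by (simp add: power2_eq_square)
      moreover have "16 * q t0 = 4 * y + 2 * y\<^sup>2 - 1"
        unfolding q_def cos_double_cos by (simp add: y_def field_simps)
      ultimately show False using \<open>q t0 < 1/32 + 1/400\<close> \<open>1/2 \<le> y\<close> by linarith
    qed
    have "f t \<le> f t0"
    proof (rule DERIV_nonneg_imp_nondecreasing[OF t(2)])
      fix x assume x: "t \<le> x" "x \<le> t0"
      have "cos x \<le> cos t" "cos t0 \<le> cos x" using x t by (auto intro!: cos_monotone_0_pi_le)
      then have cx: "cos x < 0" "- 1/2 < cos x" using False c0 by auto
      have sx: "1/2 \<le> sin x"
      proof (rule power2_le_imp_le)
        have "(cos x)\<^sup>2 \<le> (1/2)\<^sup>2" using cx by (intro power2_le_iff_abs_le[THEN iffD2]) auto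
        then show "(1/2)\<^sup>2 \<le> (sin x)\<^sup>2" using sin_cos_squared_add[of x] by (simp add: power2_eq_square)
        show "0 \<le> sin x" using x t by (intro sin_ge_zero) auto
      qed
      define D where "D = of_real A * w x * (1 + 2 * w x + err_plus_deriv n (\<zeta> x))"
      have "(\<zeta> has_vector_derivative \<i> * of_real s) (at x)"
      proof -
        have "\<zeta> = (\<lambda>t. complex_of_real (- ln 4) + \<i> * (of_real m + of_real s * of_real t))"
          by (auto simp: \<zeta>_def complex_eq_iff)
        then show ?thesis by (auto intro!: derivative_eq_intros simp: has_vector_derivative_def scaleR_conv_of_real)
      qed
      moreover have "((\<lambda>z. g (chart n z)) has_field_derivative D) (at (\<zeta> x))"
        unfolding D_def w_def A_def by (rule DERIV_g_chart)
      ultimately have "(((\<lambda>z. g (chart n z)) \<circ> \<zeta>) has_vector_derivative (\<i> * of_real s * D)) (at x)"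
        by (rule field_vector_diff_chain_at)
      then have "((\<lambda>x. Re (((\<lambda>z. g (chart n z)) \<circ> \<zeta>) x)) has_vector_derivative Re (\<i> * of_real s * D)) (at x)"
        by (rule bounded_linear.has_vector_derivative[OF bounded_linear_Re])
      then have "(f has_real_derivative Re (\<i> * of_real s * D)) (at x)"
        unfolding has_real_derivative_iff_has_vector_derivative by (simp add: f_def[abs_def] comp_def)
      moreover have "0 \<le> Re (\<i> * of_real s * D)"
      proof -
        have "D = of_real A * (w x + 2 * (w x)\<^sup>2 + w x * err_plus_deriv n (\<zeta> x))"
          by (simp add: D_def power2_eq_square algebra_simps)
        then have "Im D = A * Im (w x + 2 * (w x)\<^sup>2 + w x * err_plus_deriv n (\<zeta> x))"
          by (simp only: Re_complex_of_real Im_complex_of_real times_complex.sel)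
        also have "Im (w x + 2 * (w x)\<^sup>2 + w x * err_plus_deriv n (\<zeta> x)) 
            = - (s * sin x) / 4 + s * sin (2 * x) / 8 + Im (w x * err_plus_deriv n (\<zeta> x))"
          unfolding w2 plus_complex.sel by (simp add: w cs)
        finally have Im_D: "Im D = A * (- (s * sin x) / 4 + s * sin (2 * x) / 8 + Im (w x * err_plus_deriv n (\<zeta> x)))" .
        have "Re (\<i> * of_real s * D) = - s * Im D" by simp
        moreover have "- s * (A * (- (s * sin x) / 4 + s * sin (2 * x) / 8 + y)) =
            A * ((s * s) * (sin x / 4 - sin (2 * x) / 8) - s * y)" for y
          by (simp add: field_simps)
        ultimately have "Re (\<i> * of_real s * D) =
            A * ((s * s) * (sin x / 4 - sin (2 * x) / 8) - s * Im (w x * err_plus_deriv n (\<zeta> x)))"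
          by (simp only: Im_D)
        also have "s * s = 1" using s by auto
        also have "1 * (sin x / 4 - sin (2 * x) / 8) = sin x * (1 - cos x) / 4"
          unfolding sin_double by (simp add: field_simps)
        finally have *: "Re (\<i> * of_real s * D) = A * (sin x * (1 - cos x) / 4 - s * Im (w x * err_plus_deriv n (\<zeta> x)))" .
        have "\<bar>Im (w x * err_plus_deriv n (\<zeta> x))\<bar> \<le> 1/200"
          using abs_Im_le_cmod[of "w x * err_plus_deriv n (\<zeta> x)"] d[of x] by (simp only: norm_mult nw)
        moreover have "s * y \<le> \<bar>y\<bar>" for y using s by auto
        ultimately have "s * Im (w x * err_plus_deriv n (\<zeta> x)) \<le> 1/200" by (rule order_trans[rotated])
        moreover have "1/2 * 1 \<le> sin x * (1 - cos x)" using sx cx by (intro mult_mono) auto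
        ultimately show ?thesis unfolding * using A by (intro mult_nonneg_nonneg) auto
      qed
      ultimately show "\<exists>y. (f has_real_derivative y) (at x) \<and> 0 \<le> y" by blast
    qed
    then show ?thesis using t0 by (simp add: f_def)
  qed
qed

text \<open>
  A critical point is a solution of \<open>exp \<zeta> = - (1 + d) / 2\<close> with a small perturbation
  \<open>d = err_plus_deriv n \<zeta>\<close>, that is, a fixed point of \<open>\<zeta> \<mapsto> c + Ln (1 + d)\<close> for \<open>exp c = -1/2\<close>. Brouwer's
  theorem provides it, as \<open>|Ln (1 + d)| \<le> 2 |d| \<le> 1/10\<close>.
\<close>

lemma exists_critical_point_near:
  assumes n: "4 \<le> n" "tail_bound n \<le> 1/100" and m: "cis m = - 1"
  obtains \<zeta> where "\<zeta> \<in> cball (Complex (- ln 2) m) (1/10)" "deriv g (chart n \<zeta>) = 0"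
proof -
  define c where "c = Complex (- ln 2) m"
  have ec: "exp c = - 1/2"
    using m by (simp add: c_def exp_eq_polar exp_minus)
  have big: "(32::real) \<le> 2 ^ Suc n" using power_increasing[of 5 "Suc n" "2::real"] n by simp
  have d: "cmod (err_plus_deriv n \<zeta>) \<le> 1/50" if "\<zeta> \<in> cball c (1/10)" for \<zeta>
  proof -
    have "\<bar>Re c - Re \<zeta>\<bar> \<le> 1/10"
      using that abs_Re_le_cmod[of "c - \<zeta>"] by (simp add: dist_norm)
    then have "\<bar>Re \<zeta>\<bar> \<le> 1"
      using ln2_le_25_over_36 ln_gt_zero[of "2::real"] unfolding c_def complex.sel by linarith
    then have "\<bar>Re \<zeta>\<bar> \<le> 2 ^ Suc n * (7/20)" using big by linarith
    then show ?thesis using norm_err_plus_deriv_le[of \<zeta> n] n by simp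
  qed
  define F where "F \<zeta> = c + Ln (1 + err_plus_deriv n \<zeta>)" for \<zeta>
  have nz: "1 + err_plus_deriv n \<zeta> \<notin> \<real>\<^sub>\<le>\<^sub>0" if "\<zeta> \<in> cball c (1/10)" for \<zeta>
    using d[OF that] abs_Re_le_cmod[of "err_plus_deriv n \<zeta>"] by (auto simp: complex_nonpos_Reals_iff)
  have "continuous_on UNIV (err_plus_deriv n)"
    unfolding err_plus_deriv_def
    by (intro holomorphic_on_imp_continuous_on holomorphic_intros holomorphic_err open_UNIV)
  then have "continuous_on (cball c (1/10)) (err_plus_deriv n)" by (rule continuous_on_subset) simp
  then have "continuous_on (cball c (1/10)) F"
    unfolding F_def using nz by (intro continuous_intros) auto
  moreover have "F \<in> cball c (1/10) \<rightarrow> cball c (1/10)"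
  proof
    fix \<zeta> assume \<zeta>: "\<zeta> \<in> cball c (1/10)"
    have "cmod (Ln (1 + err_plus_deriv n \<zeta>)) \<le> 2 * cmod (err_plus_deriv n \<zeta>)" using d[OF \<zeta>] by (intro norm_Ln_le) simp
    then show "F \<zeta> \<in> cball c (1/10)" using d[OF \<zeta>] by (simp add: F_def dist_norm)
  qed
  ultimately obtain \<zeta> where \<zeta>: "\<zeta> \<in> cball c (1/10)" "F \<zeta> = \<zeta>"
    using brouwer_ball[of "1/10" c F] by auto
  have "1 + err_plus_deriv n \<zeta> \<noteq> 0" using nz[OF \<zeta>(1)] by auto
  then have "exp \<zeta> = - 1/2 * (1 + err_plus_deriv n \<zeta>)"
    using arg_cong[OF \<zeta>(2), of exp] by (simp add: F_def exp_add ec)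
  then have "deriv g (chart n \<zeta>) = 0" unfolding deriv_g_chart_eq_0_iff by (simp add: field_simps)
  with \<zeta>(1) that show thesis by (simp add: c_def)
qed

text \<open>
  The unbounded component meets the circle \<open>|w| = 1/4\<close> for all large \<open>n\<close>. From the meeting point
  the arc to \<open>w = -1/4\<close>, the segment to \<open>w = -1/2\<close> and the disc around it with the critical point form a
  connected set on which \<open>Re g < L\<close>.
\<close>

lemma unbounded_left_component_has_critical_point:
  assumes U: "U \<in> components {z. Re (g z) < L}" and unb: "\<not> bounded U"
  obtains c where "c \<in> U" "deriv g c = 0"
proof -
  have conn: "connected U" using U by (rule in_components_connected)
  obtain z where z: "z \<in> U" using unb by fastforce
  obtain n0 :: nat where n0: "32 * \<bar>L\<bar> + cmod z < real n0" using reals_Archimedean2 by blast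
  obtain n where n: "4 \<le> n" "n0 \<le> n" "tail_bound n \<le> 1/100"
  proof -
    show thesis
      using that eventually_happens'[OF _ eventually_conj[OF eventually_tail_bound_le
            eventually_ge_at_top[of "max 4 n0"]]] by fastforce
  qed
  have nA: "32 * \<bar>L\<bar> < amp n" using amp_ge_index[of n] n n0 norm_ge_zero[of z] by linarith
  define R where "R = 2 ^ (n + 3) * exp (- ln (4::real) / 2 ^ Suc n)"
  have "cmod z \<le> R"
  proof -
    have "cmod z \<le> real n" using n0 n by linarith
    also have "\<dots> \<le> 2 ^ n" using less_exp[of n] by (simp add: less_imp_le)
    also have "\<dots> \<le> 2 ^ (n + 3) * exp (- ln (4::real))" by (simp add: exp_minus power_add)
    also have "\<dots> \<le> R"
    proof -
      have "- ln (4::real) \<le> - ln 4 / 2 ^ Suc n" 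
        using divide_left_mono[of 1 "2 ^ Suc n" "ln (4::real)"] one_le_power[of "2::real" "Suc n"] by simp
      then show ?thesis unfolding R_def by simp
    qed
    finally show ?thesis .
  qed
  then obtain z1 where z1: "z1 \<in> U" "cmod z1 = R"
    using unbounded_connected_meets_spheres[OF conn unb z] by blast
  obtain \<zeta>0 where \<zeta>0: "Re \<zeta>0 = - ln 4" "chart n \<zeta>0 = z1"
    using chart_surj z1(2) unfolding R_def by blast
  \<comment> \<open>\<open>m\<close> is the odd multiple of \<open>pi\<close> nearest to \<open>Im \<zeta>0\<close>; there \<open>w\<close> is negative.\<close>
  define k where "k = round ((Im \<zeta>0 - pi) / (2 * pi))"
  define m where "m = pi + 2 * pi * of_int k"
  define t0 where "t0 = \<bar>Im \<zeta>0 - m\<bar>"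
  define s :: real where "s = (if m \<le> Im \<zeta>0 then 1 else -1)"
  have m: "cis m = - 1"
    unfolding m_def using cis_multiple_2pi[of "of_int k"] by (simp add: cis_mult[symmetric])
  have s: "s = 1 \<or> s = -1" by (simp add: s_def)
  have "t0 \<le> pi"
  proof -
    have "\<bar>(Im \<zeta>0 - pi) / (2 * pi) - of_int k\<bar> \<le> 1/2"
      using of_int_round_abs_le[of "(Im \<zeta>0 - pi) / (2 * pi)"] by (simp add: k_def abs_minus_commute)
    then have "2 * pi * \<bar>(Im \<zeta>0 - pi) / (2 * pi) - of_int k\<bar> \<le> 2 * pi * (1/2)"
      by (intro mult_left_mono) auto
    moreover have "2 * pi * \<bar>(Im \<zeta>0 - pi) / (2 * pi) - of_int k\<bar> 
        = \<bar>2 * pi * ((Im \<zeta>0 - pi) / (2 * pi) - of_int k)\<bar>" by (simp only: abs_mult) simp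
    moreover have "2 * pi * ((Im \<zeta>0 - pi) / (2 * pi) - of_int k) = Im \<zeta>0 - m"
      by (simp add: m_def field_simps)
    ultimately show ?thesis by (simp add: t0_def)
  qed
  have \<zeta>0_eq: "\<zeta>0 = Complex (- ln 4) (m + s * t0)"
    using \<zeta>0(1) by (auto simp: complex_eq_iff s_def t0_def)
  have start: "Re (g (chart n (Complex (- ln 4) (m + s * t0)))) < L"
    using in_components_subset[OF U] z1(1) \<zeta>0(2) unfolding \<zeta>0_eq by blast
  define P where "P = (\<lambda>t. Complex (- ln 4) (m + s * t)) ` {0..t0}"
  define Q where "Q = (\<lambda>x. Complex x m) ` {- ln 4..- ln 2}"
  define B where "B = cball (Complex (- ln 2) m) (1/10)"
  have ln4: "ln (4::real) = 2 * ln 2" using ln_realpow[of 2 2] by simp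
  have ln2: "0 < ln (2::real)" by simp
  have "connected (P \<union> Q \<union> B)"
  proof (intro connected_Un)
    show "connected P" unfolding P_def
      by (intro connected_continuous_image) (auto simp: Complex_eq intro!: continuous_intros)
    show "connected Q" unfolding Q_def
      by (intro connected_continuous_image) (auto simp: Complex_eq intro!: continuous_intros)
    show "connected B" unfolding B_def by simp
    have "Complex (- ln 4) m \<in> P" unfolding P_def by (rule image_eqI[of _ _ 0]) (auto simp: t0_def)
    moreover have "Complex (- ln 4) m \<in> Q" unfolding Q_def using ln4 ln2 by (intro imageI) auto
    ultimately show "P \<inter> Q \<noteq> {}" by blast
    have "Complex (- ln 2) m \<in> Q" unfolding Q_def using ln4 ln2 by (intro imageI) auto
    moreover have "Complex (- ln 2) m \<in> B" unfolding B_def by simp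
    ultimately show "(P \<union> Q) \<inter> B \<noteq> {}" by blast
  qed
  then have "connected (chart n ` (P \<union> Q \<union> B))"
    by (rule connected_continuous_image[OF continuous_on_chart])
  moreover have "Re (g (chart n \<zeta>)) < L" if "\<zeta> \<in> P \<union> Q \<union> B" for \<zeta>
    using that
  proof (elim UnE)
    assume "\<zeta> \<in> P"
    then obtain t where "0 \<le> t" "t \<le> t0" "\<zeta> = Complex (- ln 4) (m + s * t)" by (auto simp: P_def)
    then show ?thesis using Re_g_less_along_arc[OF n(1,3) nA m s _ _ \<open>t0 \<le> pi\<close> start] by blast
  next
    assume "\<zeta> \<in> Q"
    then obtain x where x: "- ln 4 \<le> x" "x \<le> - ln 2" "\<zeta> = Complex x m" by (auto simp: Q_def)
    have "exp \<zeta> + 1/2 = of_real (1/2 - exp x)" using m by (simp add: x(3) exp_eq_polar)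
    moreover have "exp (- ln 4) \<le> exp x" "exp x \<le> exp (- ln (2::real))" using x by auto
    then have "1/4 \<le> exp x" "exp x \<le> 1/2" by (auto simp: exp_minus)
    ultimately have "cmod (exp \<zeta> + 1/2) \<le> 1/4" by (simp only: norm_of_real)
    moreover have "\<bar>Re \<zeta>\<bar> \<le> 2" using x ln4 ln2 ln2_le_25_over_36 by simp
    ultimately show ?thesis by (intro Re_g_less_near_minus_half n nA)
  next
    assume "\<zeta> \<in> B"
    define u where "u = \<zeta> - Complex (- ln 2) m"
    have u: "cmod u \<le> 1/10" using \<open>\<zeta> \<in> B\<close> by (simp add: B_def u_def dist_norm norm_minus_commute)
    have "exp \<zeta> = exp (Complex (- ln 2) m) * exp u" by (simp add: u_def exp_diff)
    also have "exp (Complex (- ln 2) m) = - 1/2" using m by (simp add: exp_eq_polar exp_minus)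
    finally have "exp \<zeta> + 1/2 = (1 - exp u) / 2" by (simp add: field_simps)
    then have "cmod (exp \<zeta> + 1/2) = cmod (exp u - 1) / 2"
      by (simp only: norm_divide norm_numeral norm_minus_commute[of 1])
    moreover have "cmod (exp u - 1) \<le> 1/2" using norm_exp_bounds(2)[of u] u by simp
    ultimately have "cmod (exp \<zeta> + 1/2) \<le> 1/4" by simp
    moreover have "Re \<zeta> = - ln 2 + Re u" by (simp add: u_def)
    then have "\<bar>Re \<zeta>\<bar> \<le> 2" using u abs_Re_le_cmod[of u] ln2 ln2_le_25_over_36 by linarith
    ultimately show ?thesis by (intro Re_g_less_near_minus_half n nA)
  qed
  then have "chart n ` (P \<union> Q \<union> B) \<subseteq> {z. Re (g z) < L}" by blast
  moreover have "\<zeta>0 \<in> P" unfolding P_def \<zeta>0_eq by (intro imageI) (auto simp: t0_def)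
  then have "U \<inter> chart n ` (P \<union> Q \<union> B) \<noteq> {}" using \<zeta>0(2) z1(1) by blast
  ultimately have sub: "chart n ` (P \<union> Q \<union> B) \<subseteq> U" by (intro components_maximal[OF U])
  obtain \<zeta> where "\<zeta> \<in> B" "deriv g (chart n \<zeta>) = 0"
    unfolding B_def by (rule exists_critical_point_near[OF n(1,3) m])
  then show thesis using sub by (intro that[of "chart n \<zeta>"]) auto
qed



section \<open>Infinitely many direct singularities over infinity\<close>

text \<open>
  The condition \<open>Re z = |z| * cos \<sigma>\<close> describes the pair of rays \<open>arg z = \<plusminus> \<sigma>\<close>. Since
  \<open>Re (w\<^sup>2) = 2 * (Re w)\<^sup>2 - |w|\<^sup>2\<close>, squaring acts on it like angle doubling.
\<close>

lemma Re_power_on_ray: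
  assumes "Re z = cmod z * cos \<sigma>"
  shows "Re (z ^ (2 ^ k)) = cmod z ^ (2 ^ k) * cos (2 ^ k * \<sigma>)"
proof (induction k)
  case (Suc k)
  define w where "w = z ^ (2 ^ k)"
  have dbl: "(2::nat) ^ Suc k = 2 ^ k * 2" by simp
  have "z ^ (2 ^ Suc k) = w\<^sup>2" unfolding w_def dbl by (rule power_mult)
  moreover have "Re (w\<^sup>2) = 2 * (Re w)\<^sup>2 - (cmod w)\<^sup>2"
    unfolding cmod_power2 by (simp add: power2_eq_square)
  moreover have "cmod w = cmod z ^ (2 ^ k)" by (simp add: w_def norm_power)
  ultimately have "Re (z ^ (2 ^ Suc k)) = (cmod z ^ (2 ^ k))\<^sup>2 * (2 * (cos (2 ^ k * \<sigma>))\<^sup>2 - 1)"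
    using Suc.IH by (simp add: w_def power_mult_distrib algebra_simps)
  also have "2 * (cos (2 ^ k * \<sigma>))\<^sup>2 - 1 = cos (2 * (2 ^ k * \<sigma>))" by (rule cos_double_cos[symmetric])
  also have "(cmod z ^ (2 ^ k))\<^sup>2 = cmod z ^ (2 ^ Suc k)" unfolding dbl by (rule power_mult[symmetric])
  finally show ?case by (simp only: power_Suc mult.assoc)
qed (use assms in simp)

lemma Re_g_term_on_ray:
  assumes "Re z = cmod z * cos \<sigma>"
  shows "Re ((z / 2 ^ Suc k) ^ (2 ^ Suc k)) = term_size k (cmod z) * cos (2 ^ Suc k * \<sigma>)"
proof -
  have "z / 2 ^ Suc k = z / complex_of_real (2 ^ Suc k)" by simp
  then have "Re (z / 2 ^ Suc k) = Re z / 2 ^ Suc k" by (simp only: Re_divide_of_real)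
  moreover have n: "cmod (z / 2 ^ Suc k) = cmod z / 2 ^ Suc k"
    by (simp only: norm_divide norm_power norm_numeral)
  ultimately have "Re (z / 2 ^ Suc k) = cmod (z / 2 ^ Suc k) * cos \<sigma>" using assms by simp
  from Re_power_on_ray[OF this, of "Suc k"] show ?thesis
    by (simp only: n term_size_def)
qed

lemma Re_g_on_ray:
  assumes "Re z = cmod z * cos \<sigma>" and \<kappa>: "\<And>k. m \<le> k \<Longrightarrow> cos (2 ^ Suc k * \<sigma>) = \<kappa>"
  obtains R where "term_size m (cmod z) \<le> R"
    "Re (g z) = (\<Sum>k<m. term_size k (cmod z) * cos (2 ^ Suc k * \<sigma>)) + \<kappa> * R"
proof
  let ?T = "\<lambda>k. term_size k (cmod z)"
  let ?R = "\<Sum>j. ?T (j + m)"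
  have sm: "summable (\<lambda>j. ?T (j + m))" by (rule summable_ignore_initial_segment[OF summable_term_size])
  have "sum (\<lambda>j. ?T (j + m)) {0} \<le> ?R"
    by (rule sum_le_suminf[OF sm]) (auto simp: term_size_nonneg)
  then show "?T m \<le> ?R" by simp
  have sm': "summable (\<lambda>k. ?T k * cos (2 ^ Suc k * \<sigma>))"
    using summable_Re[OF summable_g[of z]] unfolding Re_g_term_on_ray[OF assms(1)] .
  have "Re (g z) = (\<Sum>k. ?T k * cos (2 ^ Suc k * \<sigma>))"
    unfolding g_def Re_suminf[OF summable_g] Re_g_term_on_ray[OF assms(1)] ..
  also have "\<dots> = (\<Sum>j. ?T (j + m) * cos (2 ^ Suc (j + m) * \<sigma>)) + (\<Sum>k<m. ?T k * cos (2 ^ Suc k * \<sigma>))"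
    by (rule suminf_split_initial_segment[OF sm'])
  also have "(\<lambda>j. ?T (j + m) * cos (2 ^ Suc (j + m) * \<sigma>)) = (\<lambda>j. \<kappa> * ?T (j + m))"
    using \<kappa> by (simp add: fun_eq_iff del: power_Suc)
  also have "suminf (\<lambda>j. \<kappa> * ?T (j + m)) = \<kappa> * ?R" by (rule suminf_mult[OF sm])
  finally show "Re (g z) = (\<Sum>k<m. ?T k * cos (2 ^ Suc k * \<sigma>)) + \<kappa> * ?R" by simp
qed

lemma term_size_Suc_square: "term_size (Suc k) r = (term_size k r)\<^sup>2 / amp k"
proof -
  have "r / 2 ^ (k + 3) = (r / 2 ^ Suc k) / 4" by (simp add: power_add)
  then have "(r / 2 ^ (k + 3)) ^ (2 ^ Suc k) = term_size k r / amp k"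
    by (simp only: power_divide[of _ 4] term_size_def amp_def)
  then show ?thesis unfolding term_size_Suc by (simp add: power2_eq_square)
qed

text \<open>
  By \<open>t (m+1) = (t m)\<^sup>2 / amp m\<close>, adding the term of index \<open>m\<close> costs at most the maximum
  \<open>amp m / c\<close> of \<open>2 * x - c * x\<^sup>2 / amp m\<close>.
\<close>

lemma sum_terms_dominated:
  assumes "0 < c"
  shows "\<exists>M. \<forall>r\<ge>0. (\<Sum>k<m. term_size k r) - c * term_size m r \<le> M"
  using assms
proof (induction m arbitrary: c)
  case 0
  then show ?case by (intro exI[of _ 0]) (auto simp: term_size_nonneg)
next
  case (Suc m)
  obtain M where M: "\<And>r. 0 \<le> r \<Longrightarrow> (\<Sum>k<m. term_size k r) - 1 * term_size m r \<le> M"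
    using Suc.IH[of 1] by auto
  show ?case
  proof (intro exI[of _ "M + amp m / c"] allI impI)
    fix r :: real assume "0 \<le> r"
    define x where "x = term_size m r"
    have "0 \<le> (c * x - amp m)\<^sup>2 / (c * amp m)"
      using Suc.prems amp_pos[of m] by (intro divide_nonneg_pos) auto
    also have "\<dots> = c * (x\<^sup>2 / amp m) - 2 * x + amp m / c"
      using Suc.prems amp_pos[of m] by (simp add: power2_eq_square field_simps)
    finally show "(\<Sum>k<Suc m. term_size k r) - c * term_size (Suc m) r \<le> M + amp m / c"
      using M[OF \<open>0 \<le> r\<close>] by (simp add: term_size_Suc_square x_def)
  qed
qed

text \<open>
  In the direction \<open>ridge m\<close> all terms of index at least \<open>m\<close> are positive, in the direction \<open>valley m\<close> their
  real part is \<open>-1/2\<close> times their modulus. The directions are interlaced: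
  \<open>ridge (m+1) < valley m < ridge m\<close>.
\<close>

definition ridge :: "nat \<Rightarrow> real" where "ridge m = pi / 2 ^ m"

definition valley :: "nat \<Rightarrow> real" where "valley m = 2 * pi / 3 / 2 ^ m"

lemma cos_ridge: "m \<le> k \<Longrightarrow> cos (2 ^ Suc k * ridge m) = 1"
proof -
  assume "m \<le> k"
  then obtain j where k: "k = m + j" using le_Suc_ex by blast
  have "2 ^ Suc k * ridge m = 2 * real (2 ^ j) * pi" by (simp add: k ridge_def power_add)
  then show ?thesis by (simp only: cos_2npi)
qed

lemma cos_valley: "m \<le> k \<Longrightarrow> cos (2 ^ Suc k * valley m) = - 1/2"
proof -
  assume "m \<le> k"
  then obtain j where k: "k = m + j" using le_Suc_ex by blast
  have "cos (2 ^ j * (4 * pi / 3)) = - 1/2"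
  proof (induction j)
    case 0
    have "cos (2 * (2 * pi / 3)) = - 1/2"
      unfolding cos_double_cos by (simp add: cos_120 power2_eq_square)
    then show ?case by simp
  next
    case (Suc j)
    have "cos (2 * (2 ^ j * (4 * pi / 3))) = - 1/2"
      unfolding cos_double_cos Suc.IH by (simp add: power2_eq_square)
    then show ?case by simp
  qed
  moreover have "2 ^ Suc k * valley m = 2 ^ j * (4 * pi / 3)" by (simp add: k valley_def power_add)
  ultimately show ?thesis by (simp only:)
qed

lemma Re_g_bounded_on_valley:
  obtains M where "\<And>z. Re z = cmod z * cos (valley m) \<Longrightarrow> Re (g z) \<le> M"
proof -
  obtain M where M: "\<And>r. 0 \<le> r \<Longrightarrow> (\<Sum>k<m. term_size k r) - 1/2 * term_size m r \<le> M"
    using sum_terms_dominated[of "1/2" m] by auto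
  show thesis
  proof (rule that)
    fix z assume z: "Re z = cmod z * cos (valley m)"
    obtain R where R: "term_size m (cmod z) \<le> R"
      "Re (g z) = (\<Sum>k<m. term_size k (cmod z) * cos (2 ^ Suc k * valley m)) + (- 1/2) * R"
      by (rule Re_g_on_ray[OF z cos_valley])
    have "(\<Sum>k<m. term_size k (cmod z) * cos (2 ^ Suc k * valley m)) \<le> (\<Sum>k<m. term_size k (cmod z))"
      by (intro sum_mono mult_left_le term_size_nonneg) auto
    with R M[of "cmod z"] show "Re (g z) \<le> M" by simp
  qed
qed

definition ridge_ray :: "nat \<Rightarrow> real \<Rightarrow> complex" where
  "ridge_ray m t = of_real t * cis (ridge m)"

lemma continuous_on_ridge_ray: "continuous_on S (ridge_ray m)"
  unfolding ridge_ray_def by (intro continuous_intros)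

lemma h_tendsto_Infty_on_ridge_ray: "((\<lambda>t. Fin (h (ridge_ray m t))) \<longlongrightarrow> Infty) at_top"
proof (rule Fin_tendsto_Infty)
  obtain M where M: "\<And>r. 0 \<le> r \<Longrightarrow> (\<Sum>k<m. term_size k r) - 1/2 * term_size m r \<le> M"
    using sum_terms_dominated[of "1/2" m] by auto
  have "1/2 * term_size m t - M \<le> Re (g (ridge_ray m t))" if "0 \<le> t" for t
  proof -
    have ct: "cmod (ridge_ray m t) = t" using that by (simp add: ridge_ray_def norm_mult)
    then have "Re (ridge_ray m t) = cmod (ridge_ray m t) * cos (ridge m)"
      by (simp add: ridge_ray_def)
    then obtain R where R: "term_size m t \<le> R"
      "Re (g (ridge_ray m t)) = (\<Sum>k<m. term_size k t * cos (2 ^ Suc k * ridge m)) + 1 * R"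
      using Re_g_on_ray[of "ridge_ray m t" "ridge m" m 1] cos_ridge unfolding ct by metis
    have "- (\<Sum>k<m. term_size k t) = (\<Sum>k<m. term_size k t * (-1))"
      by (simp add: sum_negf)
    also have "\<dots> \<le> (\<Sum>k<m. term_size k t * cos (2 ^ Suc k * ridge m))"
      by (intro sum_mono mult_left_mono term_size_nonneg that cos_ge_minus_one)
    finally show ?thesis using R M[OF that] by simp
  qed
  moreover have "filterlim (\<lambda>t. 1/2 * term_size m t - M) at_top at_top"
  proof -
    have "filterlim (\<lambda>t::real. t * (1 / 2 ^ Suc m)) at_top at_top"
      by (rule filterlim_at_top_mult_tendsto_pos[OF tendsto_const _ filterlim_ident]) simp
    then have "filterlim (\<lambda>t::real. t / 2 ^ Suc m) at_top at_top" by simp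
    then have "filterlim (term_size m) at_top at_top"
      unfolding term_size_def[abs_def] by (intro filterlim_pow_at_top) auto
    then have "filterlim (\<lambda>t. 1/2 * term_size m t) at_top at_top"
      by (rule filterlim_tendsto_pos_mult_at_top[OF tendsto_const, rotated]) simp
    then show ?thesis
      using filterlim_tendsto_add_at_top[OF tendsto_const[of "- M"]] by fastforce
  qed
  ultimately have "filterlim (\<lambda>t. Re (g (ridge_ray m t))) at_top at_top"
    by (elim filterlim_at_top_mono) (auto intro: eventually_mono[OF eventually_ge_at_top[of 0]])
  then have "filterlim (\<lambda>t. exp (Re (g (ridge_ray m t)))) at_top at_top"
    by (rule filterlim_compose[OF exp_at_top])
  then show "filterlim (\<lambda>t. cmod (h (ridge_ray m t))) at_top at_top"
    by (simp add: h_def)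
qed

text \<open>
  The function \<open>Re z - |z| * cos (valley m)\<close> has opposite signs on the two rays. A component
  containing late points of both would contain a zero of it, where \<open>Re g\<close> is bounded above.
\<close>

lemma tract_ridge_ray_distinct:
  assumes "m < m'"
  shows "tract h Infty (ridge_ray m) \<noteq> tract h Infty (ridge_ray m')"
proof
  assume eq: "tract h Infty (ridge_ray m) = tract h Infty (ridge_ray m')"
  obtain M where M: "\<And>z. Re z = cmod z * cos (valley m) \<Longrightarrow> Re (g z) \<le> M"
    using Re_g_bounded_on_valley[of m] by blast
  obtain r where r: "0 < r" "\<And>w. Fin w \<in> ball Infty r \<Longrightarrow> exp M < cmod w"
    using ball_Infty_small[of "exp M"] by blast
  let ?U = "tract h Infty (ridge_ray m) r"
  have ev: "\<forall>\<^sub>F t in at_top. ridge_ray k t \<in> tract h Infty (ridge_ray k) r" for k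
    by (rule tract_component(2)[OF continuous_on_ridge_ray h_tendsto_Infty_on_ridge_ray r(1)])
  have "\<forall>\<^sub>F t in at_top. ridge_ray m t \<in> ?U \<and> ridge_ray m' t \<in> ?U \<and> 1 \<le> t"
    using ev[of m] ev[of m'] eventually_ge_at_top[of 1] unfolding eq by eventually_elim simp
  then obtain t where t: "ridge_ray m t \<in> ?U" "ridge_ray m' t \<in> ?U" "1 \<le> t"
    using eventually_happens'[OF trivial_limit_at_top_linorder] by blast
  have comp: "?U \<in> components {z. Fin (h z) \<in> ball Infty r}"
    by (rule tract_component(1)[OF continuous_on_ridge_ray h_tendsto_Infty_on_ridge_ray r(1)])
  define u where "u z = Re z - cmod z * cos (valley m)" for z
  have ct: "cmod (ridge_ray k t) = t" for k using t(3) by (simp add: ridge_ray_def norm_mult)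
  have u_eq: "u (ridge_ray k t) = t * (cos (ridge k) - cos (valley m))" for k
    by (simp add: u_def ct) (simp add: ridge_ray_def right_diff_distrib)
  have order: "0 \<le> valley m" "valley m < ridge m" "ridge m \<le> pi"
    using one_le_power[of "2::real" m] by (auto simp: valley_def ridge_def field_simps)
  then have "cos (ridge m) < cos (valley m)" by (intro cos_monotone_0_pi)
  then have neg: "u (ridge_ray m t) \<le> 0" unfolding u_eq using t(3) by (intro mult_nonneg_nonpos) auto
  have "cos (valley m) < cos (ridge m')"
  proof (rule cos_monotone_0_pi)
    obtain j where m': "m' = Suc (m + j)" using assms less_iff_Suc_add by blast
    have p: "(1::real) \<le> 2 ^ m" "(1::real) \<le> 2 ^ j" by (rule one_le_power, simp)+
    have "ridge m' = pi / 2 ^ m / 2 ^ j / 2" by (simp add: ridge_def m' power_add)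
    also have "\<dots> \<le> pi / 2 ^ m / 1 / 2" using p by (intro divide_right_mono divide_left_mono) auto
    also have "\<dots> < valley m" by (simp add: valley_def field_simps)
    finally show "ridge m' < valley m" .
    show "0 \<le> ridge m'" by (simp add: ridge_def)
    show "valley m \<le> pi" using order by simp
  qed
  then have pos: "0 \<le> u (ridge_ray m' t)" unfolding u_eq using t(3) by (intro mult_nonneg_nonneg) auto
  have "connected (u ` ?U)"
    unfolding u_def using in_components_connected[OF comp]
    by (intro connected_continuous_image continuous_intros)
  then have "0 \<in> u ` ?U"
    using connectedD_interval[of "u ` ?U" "u (ridge_ray m t)" "u (ridge_ray m' t)" 0] t(1,2) neg pos by blast
  then obtain z where z: "z \<in> ?U" "u z = 0" by auto
  then have "Re (g z) \<le> M" by (intro M) (simp add: u_def)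
  moreover have "Fin (h z) \<in> ball Infty r" using in_components_subset[OF comp] z(1) by blast
  then have "exp M < cmod (h z)" by (rule r(2))
  ultimately show False by (simp add: h_def)
qed

lemma infinite_direct_singularities_h: "infinite {(a, U). direct_singularity h a U}"
proof -
  let ?s = "\<lambda>m. (Infty, tract h Infty (ridge_ray m))"
  have "inj ?s"
    by (rule linorder_injI) (use tract_ridge_ray_distinct in auto)
  then have "infinite (range ?s)" by (rule range_inj_infinite)
  moreover have "range ?s \<subseteq> {(a, U). direct_singularity h a U}"
    using direct_singularity_over_Infty[OF continuous_on_ridge_ray h_tendsto_Infty_on_ridge_ray] by auto
  ultimately show ?thesis by (rule infinite_super[rotated])
qed

section \<open>Absence of logarithmic singularities\<close>

lemma preimage_h_ball_0_eq_left_half_plane: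
  assumes "0 < r" "r < pi"
  shows "{z. Fin (h z) \<in> ball (Fin 0) r} = {z. Re (g z) < ln (tan (r / 2))}"
proof -
  have "0 < tan (r / 2)" using assms by (intro tan_gt_zero) auto
  then have "exp (Re (g z)) < tan (r / 2) \<longleftrightarrow> Re (g z) < ln (tan (r / 2))" for z
    by (metis exp_ln exp_less_cancel_iff)
  then show ?thesis unfolding Fin_in_ball_0_iff[OF assms] norm_h by simp
qed

lemma universal_covering_imp_deriv_nonzero:
  assumes cov: "universal_covering X (\<lambda>z. Fin (f z)) S" and f: "f holomorphic_on UNIV"
    and X: "open X" "c \<in> X"
  shows "deriv f c \<noteq> 0"
proof -
  have "covering_space X (\<lambda>z. Fin (f z)) S" using cov by (simp add: universal_covering_def)
  then obtain T u q where T: "c \<in> T" "openin (top_of_set X) T" "homeomorphism T u (\<lambda>z. Fin (f z)) q"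
    using covering_space_local_homeomorphism[OF _ X(2)] by metis
  have "open T" using T(2) X(1) by (simp add: openin_open_eq)
  moreover have "inj_on f T"
  proof (rule inj_onI)
    fix x y assume "x \<in> T" "y \<in> T" "f x = f y"
    then show "x = y" using homeomorphism_apply1[OF T(3)] by metis
  qed
  ultimately show ?thesis
    using holomorphic_injective_imp_regular[of f T c] f T(1) holomorphic_on_subset by blast
qed

lemma not_transcendental_singularity_nonzero:
  assumes "a \<noteq> 0" shows "\<not> transcendental_singularity h (Fin a) U"
proof
  assume U: "transcendental_singularity h (Fin a) U"
  obtain r where r: "0 < r"
    "\<And>C. connected C \<Longrightarrow> C \<subseteq> {z. Fin (h z) \<in> ball (Fin a) r} \<Longrightarrow> bounded C"
    using bounded_where_h_near_nonzero[OF assms] by blast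
  have "U r \<in> components {z. Fin (h z) \<in> ball (Fin a) r}"
    using U r(1) by (simp only: transcendental_singularity_def)
  then have "bounded (U r)" using r(2) in_components_connected in_components_subset by metis
  then show False using transcendental_singularity_unbounded[OF continuous_on_h U r(1)] by simp
qed

lemma not_asymptotic_value_nonzero:
  assumes "a \<noteq> 0" shows "\<not> asymptotic_value h (Fin a)"
proof
  assume "asymptotic_value h (Fin a)"
  then obtain \<Gamma> :: "real \<Rightarrow> complex" where \<Gamma>: "continuous_on {0..} \<Gamma>"
    "filterlim (\<lambda>t. cmod (\<Gamma> t)) at_top at_top" "((\<lambda>t. Fin (h (\<Gamma> t))) \<longlongrightarrow> Fin a) at_top"
    unfolding asymptotic_value_def by blast
  obtain r where r: "0 < r"
    "\<And>C. connected C \<Longrightarrow> C \<subseteq> {z. Fin (h z) \<in> ball (Fin a) r} \<Longrightarrow> bounded C"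
    using bounded_where_h_near_nonzero[OF assms] by blast
  have "\<forall>\<^sub>F t in at_top. Fin (h (\<Gamma> t)) \<in> ball (Fin a) r"
    using tendstoD[OF \<Gamma>(3) r(1)] by (simp add: dist_commute)
  then obtain t0 where t0: "\<And>t. t0 \<le> t \<Longrightarrow> Fin (h (\<Gamma> t)) \<in> ball (Fin a) r"
    unfolding eventually_at_top_linorder by blast
  have "bounded (\<Gamma> ` {max 0 t0..})"
  proof (rule r(2))
    show "connected (\<Gamma> ` {max 0 t0..})"
      by (intro connected_continuous_image continuous_on_subset[OF \<Gamma>(1)]) auto
    show "\<Gamma> ` {max 0 t0..} \<subseteq> {z. Fin (h z) \<in> ball (Fin a) r}"
      using t0 by (intro image_subsetI CollectI) simp
  qed
  then obtain B where "\<forall>w\<in>\<Gamma> ` {max 0 t0..}. cmod w \<le> B"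
    unfolding bounded_iff by blast
  then have B: "cmod (\<Gamma> t) \<le> B" if "max 0 t0 \<le> t" for t using that by simp
  have "\<forall>\<^sub>F t in at_top. B < cmod (\<Gamma> t) \<and> max 0 t0 \<le> t"
    using \<Gamma>(2) eventually_ge_at_top[of "max 0 t0"]
    unfolding filterlim_at_top_dense by (intro eventually_conj) blast+
  then obtain t where "B < cmod (\<Gamma> t)" "max 0 t0 \<le> t"
    using eventually_happens'[OF trivial_limit_at_top_linorder] by blast
  then show False using B[of t] by simp
qed

text \<open>
  Over \<open>0\<close> the covering may be defined on a large \<open>U r\<close>; passing to \<open>s = min r 1 < pi\<close> gives
  a component of a half-plane preimage inside it, whose critical point contradicts local injectivity.
\<close>

lemma not_logarithmic_singularity_h: "\<not> logarithmic_singularity h (Fin a) U"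
proof
  assume log: "logarithmic_singularity h (Fin a) U"
  then have U: "transcendental_singularity h (Fin a) U"
    by (simp add: logarithmic_singularity_def direct_singularity_def)
  then have "a = 0" using not_transcendental_singularity_nonzero by blast
  obtain r where r: "0 < r" and cov: "universal_covering (U r) (\<lambda>z. Fin (h z)) (ball (Fin a) r - {Fin a})"
    using log unfolding logarithmic_singularity_def by blast
  have comp: "U s \<in> components {z. Fin (h z) \<in> ball (Fin 0) s}" if "0 < s" for s
    using U that unfolding \<open>a = 0\<close> by (simp only: transcendental_singularity_def)
  define s where "s = min r 1"
  have s: "0 < s" "s < pi" using r pi_gt3 by (auto simp: s_def)
  have "U s \<in> components {z. Re (g z) < ln (tan (s / 2))}"
    using comp[OF s(1)] unfolding preimage_h_ball_0_eq_left_half_plane[OF s] .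
  moreover have "\<not> bounded (U s)"
    by (rule transcendental_singularity_unbounded[OF continuous_on_h U s(1)])
  ultimately obtain c where c: "c \<in> U s" "deriv g c = 0"
    by (rule unbounded_left_component_has_critical_point)
  have "U s \<subseteq> U r"
  proof (cases "r = s")
    case False
    then have "s < r" by (auto simp: s_def)
    then show ?thesis using U s(1) by (simp only: transcendental_singularity_def)
  qed simp
  moreover have "open (U r)"
  proof (rule open_components[OF _ comp[OF r]])
    have "continuous_on UNIV (\<lambda>z. Fin (h z))"
      using continuous_on_compose2[OF continuous_on_Fin continuous_on_h[of UNIV]] by simp
    then show "open {z. Fin (h z) \<in> ball (Fin 0) r}"
      using open_vimage[OF open_ball, of "\<lambda>z. Fin (h z)" "Fin 0" r] by (simp only: vimage_def)
  qed
  ultimately have "deriv h c \<noteq> 0"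
    using universal_covering_imp_deriv_nonzero[OF cov holomorphic_h] c(1) by blast
  then show False using c(2) by (simp add: deriv_h_eq_0_iff)
qed

lemma h_in_class_B: "h \<in> class_B"
proof -
  have "{a. asymptotic_value h (Fin a)} \<subseteq> {0}" using not_asymptotic_value_nonzero by blast
  then have "bounded {a. asymptotic_value h (Fin a)}" by (rule bounded_subset[rotated]) simp
  then show ?thesis
    using transcendental_entire_h bounded_critical_values_h by (simp add: class_B_def)
qed

theorem mainTheorem3:
  shows "infinite {(a, U). direct_singularity h a U} \<and>
         (\<forall>a U. \<not> logarithmic_singularity h (Fin a) U) \<and>
         h \<in> class_B"
  using infinite_direct_singularities_h not_logarithmic_singularity_h h_in_class_B by blast

end
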